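(* Let $-1<\alpha<\infty$, let $f\in\mathbb{A}^2_\alpha(\mathbf{D})$, let $k$ be a positive integer, and let $a_1,\dots,a_{k-1}\in\mathbf{D}$ (repetitions allowed). For $b\in\mathbf{D}$ let $(B_1,\dots,B_{k-1},B_k^b)$ be the Gram–Schmidt orthonormalization in $\mathbb{A}^2_\alpha(\mathbf{D})$ of $(B_1,\dots,B_{k-1},\tilde k^\alpha_b)$, equivalently of the generalized reproducing kernels $(\tilde k^\alpha_{a_1},\dots,\tilde k^\alpha_{a_{k-1}},\tilde k^\alpha_b)$ associated with the $k$-tuple $(a_1,\dots,a_{k-1},b)$. Then there exists $a_k\in\mathbf{D}$ such that $$|\langle f,B_k^{a_k}\rangle|^2=\sup\{|\langle f,B_k^b\rangle|^2:\ b\in\mathbf{D}\}.$$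
   Context: $\mathbf{D}$ is the open unit disc. $\mathbb{A}^2_\alpha(\mathbf{D})$ is the Hilbert space of holomorphic functions $f$ on $\mathbf{D}$ with $\|f\|^2=\int_{\mathbf{D}}|f|^2\,dA_\alpha<\infty$, where $dA_\alpha(z)=(1+\alpha)(1-|z|^2)^\alpha dA(z)$ and $dA=dx\,dy/\pi$; the inner product is $\langle f,g\rangle=\int_{\mathbf{D}}f\overline g\,dA_\alpha$. Its reproducing kernel is $k^\alpha_w(z)=\frac1{(1-\overline wz)^{2+\alpha}}$ (principal branch). For a tuple $(a_1,\dots,a_n)$ of points of $\mathbf{D}$ (repetitions allowed), $l(a_j)$ is the number of times the value $a_j$ occurs in $(a_1,\dots,a_j)$, and the generalized reproducing kernels associated with the tuple are $\tilde k^\alpha_{a_j}(z)=\left(\frac{d}{d\overline w}\right)^{l(a_j)-1}k^\alpha_w(z)\big|_{w=a_j}$. $(B_1,\dots,B_{k-1})$ is the Gram–Schmidt orthonormalization of $(\tilde k^\alpha_{a_1},\dots,\tilde k^\alpha_{a_{k-1}})$. *)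

theory Defs
  imports "HOL-Analysis.Analysis"
begin

text \<open>
  The weighted area measure
  \<open>dA\<^sub>\<alpha>(z) = (1 + \<alpha>) (1 - |z|\<^sup>2)\<^sup>\<alpha> dx dy / \<pi>\<close>, whose underlying space is the open unit disc.
\<close>

definition bergman_measure :: "real \<Rightarrow> complex measure" where
  "bergman_measure \<alpha> =
     density (restrict_space lborel (ball 0 1))
       (\<lambda>z. ennreal ((1 + \<alpha>) * (1 - (cmod z)\<^sup>2) powr \<alpha> / pi))"

definition bergman_space :: "real \<Rightarrow> (complex \<Rightarrow> complex) set" where
  "bergman_space \<alpha> =
     {f. f holomorphic_on ball 0 1 \<and> integrable (bergman_measure \<alpha>) (\<lambda>z. (cmod (f z))\<^sup>2)}"

definition bergman_inner :: "real \<Rightarrow> (complex \<Rightarrow> complex) \<Rightarrow> (complex \<Rightarrow> complex) \<Rightarrow> complex" where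
  "bergman_inner \<alpha> f g = (LINT z|bergman_measure \<alpha>. f z * cnj (g z))"

definition bergman_norm :: "real \<Rightarrow> (complex \<Rightarrow> complex) \<Rightarrow> real" where
  "bergman_norm \<alpha> f = sqrt (LINT z|bergman_measure \<alpha>. (cmod (f z))\<^sup>2)"

definition bergman_kernel :: "real \<Rightarrow> complex \<Rightarrow> complex \<Rightarrow> complex" where
  "bergman_kernel \<alpha> w z = 1 / (1 - cnj w * z) powr complex_of_real (2 + \<alpha>)"

text \<open>
  The Wirtinger derivative
  \<open>d/d(cnj w) = (d/dx + \<i> d/dy) / 2\<close>, where \<open>w = x + \<i> y\<close>.
\<close>

definition wirtinger_bar :: "(complex \<Rightarrow> complex) \<Rightarrow> complex \<Rightarrow> complex" where
  "wirtinger_bar g w =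
     (frechet_derivative g (at w) 1 + \<i> * frechet_derivative g (at w) \<i>) / 2"

text \<open>
  Tuples of points are lists, indexed from 0. The multiplicity counts the occurrences of the
  \<open>j\<close>-th entry among the entries up to and including position \<open>j\<close>, so it is at least 1.
\<close>

definition multiplicity_at :: "complex list \<Rightarrow> nat \<Rightarrow> nat" where
  "multiplicity_at a j = count_list (take (Suc j) a) (a ! j)"

definition gen_kernel :: "real \<Rightarrow> complex list \<Rightarrow> nat \<Rightarrow> complex \<Rightarrow> complex" where
  "gen_kernel \<alpha> a j z =
     (wirtinger_bar ^^ (multiplicity_at a j - 1)) (\<lambda>w. bergman_kernel \<alpha> w z) (a ! j)"

definition gen_kernels :: "real \<Rightarrow> complex list \<Rightarrow> (complex \<Rightarrow> complex) list" where
  "gen_kernels \<alpha> a = map (gen_kernel \<alpha> a) [0..<length a]"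

text \<open>
  One step of the Gram--Schmidt process: subtract from \<open>v\<close> its projection onto the span of the
  orthonormal list \<open>Bs\<close> and normalize. (A zero remainder, which occurs only for linearly dependent
  input, yields the zero function.)
\<close>

definition gram_schmidt_step ::
    "real \<Rightarrow> (complex \<Rightarrow> complex) list \<Rightarrow> (complex \<Rightarrow> complex) \<Rightarrow> complex \<Rightarrow> complex" where
  "gram_schmidt_step \<alpha> Bs v =
     (let u = (\<lambda>z. v z - (\<Sum>B\<leftarrow>Bs. bergman_inner \<alpha> v B * B z))
      in (\<lambda>z. u z / complex_of_real (bergman_norm \<alpha> u)))"

definition gram_schmidt ::
    "real \<Rightarrow> (complex \<Rightarrow> complex) list \<Rightarrow> (complex \<Rightarrow> complex) list" where
  "gram_schmidt \<alpha> vs = foldl (\<lambda>Bs v. Bs @ [gram_schmidt_step \<alpha> Bs v]) [] vs"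

text \<open>
  For \<open>a = [a\<^sub>1, \<dots>, a\<^sub>k\<^sub>-\<^sub>1]\<close>, the last member \<open>B\<^sub>k\<^sup>b\<close> of the Gram--Schmidt
  orthonormalization of the generalized kernels associated with \<open>(a\<^sub>1, \<dots>, a\<^sub>k\<^sub>-\<^sub>1, b)\<close>.
\<close>

definition next_basis_fun :: "real \<Rightarrow> complex list \<Rightarrow> complex \<Rightarrow> complex \<Rightarrow> complex" where
  "next_basis_fun \<alpha> a b = last (gram_schmidt \<alpha> (gen_kernels \<alpha> (a @ [b])))"

end

theory Submission
  imports Defs "HOL-Complex_Analysis.Complex_Analysis"
begin

text \<open>
  Let \<open>P\<close> be the orthogonal projection onto the complement of the kernels at the nodes \<open>a\<close>, and
  write \<open>m\<close> for the multiplicity of \<open>b\<close> in \<open>a\<close>. Then \<open>B\<^sub>k\<^sup>b\<close> is the normalization of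
  \<open>P (\<partial>\<^sup>m k\<^sub>b)\<close>, where \<open>\<partial>\<close> differentiates in the conjugate variable, so
  \<open>F b = |\<langle>f, B\<^sub>k\<^sup>b\<rangle>|\<close> is \<open>|\<langle>f, P (\<partial>\<^sup>m k\<^sub>b)\<rangle>| / \<parallel>P (\<partial>\<^sup>m k\<^sub>b)\<parallel>\<close>.

  The function \<open>F\<close> is continuous on the disc, even at the nodes: near \<open>b\<close>, the map \<open>P\<close> annihilates the
  Taylor terms of \<open>k\<^sub>x\<close> of order less than \<open>m\<close>, and dividing by \<open>(cnj (x - b))\<^sup>m / m!\<close> leaves a vector that
  converges to \<open>P (\<partial>\<^sup>m k\<^sub>b)\<close>. This limit is nonzero because the functional
  \<open>h \<mapsto> \<Sum>n. p\<^sub>n h\<^sup>(\<^sup>n\<^sup>)(0) / (2 + \<alpha>)\<^sub>n\<close> with \<open>p = \<Prod>j. (x - cnj a\<^sub>j)\<close> maps \<open>\<partial>\<^sup>i k\<^sub>w\<close> to the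
  derivative \<open>p\<^sup>(\<^sup>i\<^sup>)(cnj w)\<close>; it kills the kernels at the nodes but not \<open>\<partial>\<^sup>m k\<^sub>b\<close>.

  Moreover \<open>F b\<close> tends to 0 as \<open>|b|\<close> tends to 1: the norm of \<open>k\<^sub>b\<close> tends to infinity while \<open>k\<^sub>b\<close> stays bounded
  on smaller discs, so \<open>k\<^sub>b / \<parallel>k\<^sub>b\<parallel>\<close> converges weakly to 0. Hence \<open>F\<close> attains its supremum.
\<close>

subsection \<open>Conjugate derivatives of the kernel\<close>

text \<open>For \<open>s = 2 + \<alpha>\<close> and \<open>u = cnj w\<close> this is the
  \<open>i\<close>-th conjugate derivative of the kernel at \<open>w\<close>. Taking
  \<open>u\<close> as the variable turns conjugate differentiation into complex differentiation, so
  ordinary Taylor estimates apply.\<close>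

definition kernel_deriv :: "real \<Rightarrow> nat \<Rightarrow> complex \<Rightarrow> complex \<Rightarrow> complex" where
  "kernel_deriv s i u z =
     pochhammer (of_real s) i * z ^ i * (1 - u * z) powr (- (of_real s + of_nat i))"

text \<open>Keeps the base of the complex power in the open right half-plane, away from the branch
  cut.\<close>

lemma Re_one_minus_pos: "cmod u \<le> 1 \<Longrightarrow> cmod z < 1 \<Longrightarrow> 0 < Re (1 - u * z)"
proof -
  assume "cmod u \<le> 1" "cmod z < 1"
  then have "cmod (u * z) < 1"
    by (metis mult_left_le_one_le norm_ge_zero norm_mult order_le_less_trans)
  then show ?thesis
    using complex_Re_le_cmod[of "u * z"] by simp
qed

text \<open>Differentiating the power lowers its exponent by one and brings out
  \<open>(s + i) * z\<close>: the first factor extends the Pochhammer symbol, the second the power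
  of \<open>z\<close>.\<close>

lemma kernel_deriv_has_field_derivative:
  assumes "cmod u \<le> 1" "cmod z < 1"
  shows "((\<lambda>u. kernel_deriv s i u z) has_field_derivative kernel_deriv s (Suc i) u z) (at u)"
proof -
  have "1 - u * z \<notin> \<real>\<^sub>\<le>\<^sub>0"
    using Re_one_minus_pos[OF assms] by (auto simp: complex_nonpos_Reals_iff)
  then have "((\<lambda>u. (1 - u * z) powr (- (of_real s + of_nat i))) has_field_derivative
      (of_real s + of_nat i) * z * (1 - u * z) powr (- (of_real s + of_nat i) - 1)) (at u)"
    by (auto intro!: derivative_eq_intros simp: algebra_simps)
  from DERIV_cmult[OF this, of "pochhammer (of_real s) i * z ^ i"]
  moreover have "- (of_real s + of_nat (Suc i)) = - (of_real s + of_nat i) - (1 :: complex)"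
    by simp
  then have "kernel_deriv s (Suc i) u z = pochhammer (of_real s) i * z ^ i *
      ((of_real s + of_nat i) * z * (1 - u * z) powr (- (of_real s + of_nat i) - 1))"
    unfolding kernel_deriv_def by (simp only: pochhammer_rec' power_Suc mult_ac)
  ultimately show ?thesis
    by (simp only: kernel_deriv_def[abs_def])
qed

text \<open>The real derivative of the composite is \<open>\<lambda>h. G' * cnj h\<close>. Its
  values at 1 and \<open>\<i>\<close> are \<open>G'\<close> and \<open>- \<i> * G'\<close>, so the
  Wirtinger combination averages two copies of \<open>G'\<close>.\<close>

lemma wirtinger_bar_cnj:
  assumes "(G has_field_derivative G') (at (cnj w))"
  shows "wirtinger_bar (\<lambda>w. G (cnj w)) w = G'"
proof -
  have "((\<lambda>w. G (cnj w)) has_derivative (\<lambda>h. G' * cnj h)) (at w)"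
    using has_derivative_compose[OF has_derivative_cnj[OF has_derivative_ident]
      assms[unfolded has_field_derivative_def]] .
  then have "frechet_derivative (\<lambda>w. G (cnj w)) (at w) = (\<lambda>h. G' * cnj h)"
    by (rule frechet_derivative_at[symmetric])
  then show ?thesis
    by (simp add: wirtinger_bar_def field_simps)
qed

text \<open>In the iteration below, the inner derivative is known on the open disc only, which is
  enough to differentiate once more.\<close>

lemma wirtinger_bar_cong_open:
  assumes "open S" "w \<in> S" "\<And>v. v \<in> S \<Longrightarrow> g v = h v"
  shows "wirtinger_bar g w = wirtinger_bar h w"
proof -
  have "(g has_derivative D) (at w) \<longleftrightarrow> (h has_derivative D) (at w)" for D
    using has_derivative_transform_within_open[of g D w UNIV S h]
      has_derivative_transform_within_open[of h D w UNIV S g] assms by auto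
  then show ?thesis
    by (simp add: wirtinger_bar_def frechet_derivative_def)
qed

lemma wirtinger_bar_funpow_kernel:
  assumes "w \<in> ball 0 1" "z \<in> ball 0 1"
  shows "(wirtinger_bar ^^ m) (\<lambda>w. bergman_kernel \<alpha> w z) w = kernel_deriv (2 + \<alpha>) m (cnj w) z"
  using assms(1)
proof (induction m arbitrary: w)
  case 0
  then show ?case
    by (simp add: bergman_kernel_def kernel_deriv_def powr_minus_divide[symmetric]
        del: minus_add_distrib)
next
  case (Suc m)
  have "(wirtinger_bar ^^ Suc m) (\<lambda>w. bergman_kernel \<alpha> w z) w =
      wirtinger_bar (\<lambda>w. kernel_deriv (2 + \<alpha>) m (cnj w) z) w"
    using Suc by (auto intro: wirtinger_bar_cong_open[of "ball 0 1"])
  also have "\<dots> = kernel_deriv (2 + \<alpha>) (Suc m) (cnj w) z"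
    using Suc.prems assms(2)
    by (intro wirtinger_bar_cnj kernel_deriv_has_field_derivative) auto
  finally show ?case .
qed

lemma gen_kernel_eq:
  assumes "j < length a" "set a \<subseteq> ball 0 1" "z \<in> ball 0 1"
  shows "gen_kernel \<alpha> a j z = kernel_deriv (2 + \<alpha>) (multiplicity_at a j - 1) (cnj (a ! j)) z"
  unfolding gen_kernel_def
  by (rule wirtinger_bar_funpow_kernel) (use assms nth_mem in blast)+

subsection \<open>Square integrable functions\<close>

text \<open>Holomorphy is left out because the boundary argument cuts functions off by indicators.
  Functions that agree almost everywhere stay distinct, so equality of vectors is later expressed by
  a difference of norm zero.\<close>

definition square_integrable :: "'a measure \<Rightarrow> ('a \<Rightarrow> complex) set" where
  "square_integrable M = {f \<in> borel_measurable M. integrable M (\<lambda>x. (cmod (f x))\<^sup>2)}"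

lemma square_integrable_measurable: "f \<in> square_integrable M \<Longrightarrow> f \<in> borel_measurable M"
  by (simp add: square_integrable_def)

lemma square_integrable_norm_mult:
  assumes "f \<in> square_integrable M" "g \<in> square_integrable M"
  shows "integrable M (\<lambda>x. cmod (f x) * cmod (g x))"
proof (rule Bochner_Integration.integrable_bound)
  show "integrable M (\<lambda>x. (cmod (f x))\<^sup>2 + (cmod (g x))\<^sup>2)"
    using assms by (simp add: square_integrable_def)
  show "(\<lambda>x. cmod (f x) * cmod (g x)) \<in> borel_measurable M"
    using assms by (auto dest!: square_integrable_measurable)
  have "\<bar>p * q\<bar> \<le> p\<^sup>2 + q\<^sup>2" if "p \<ge> 0" "q \<ge> 0" for p q :: real
    using mult_nonneg_nonneg[OF that] sum_squares_bound[of p q] by linarith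
  then show "AE x in M. norm (cmod (f x) * cmod (g x)) \<le> norm ((cmod (f x))\<^sup>2 + (cmod (g x))\<^sup>2)"
    by simp
qed

lemma square_integrable_mult_cnj:
  assumes "f \<in> square_integrable M" "g \<in> square_integrable M"
  shows "integrable M (\<lambda>x. f x * cnj (g x))"
proof (rule Bochner_Integration.integrable_bound[OF square_integrable_norm_mult[OF assms]])
  show "(\<lambda>x. f x * cnj (g x)) \<in> borel_measurable M"
    using assms
    by (intro borel_measurable_times measurable_compose[OF _ borel_measurable_continuous_onI[of cnj]])
       (auto dest!: square_integrable_measurable intro: continuous_intros)
qed (simp add: norm_mult)

lemma square_integrable_cmult:
  "f \<in> square_integrable M \<Longrightarrow> (\<lambda>x. c * f x) \<in> square_integrable M"
  by (auto simp: square_integrable_def norm_mult power_mult_distrib)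

lemma square_integrable_divide:
  "f \<in> square_integrable M \<Longrightarrow> (\<lambda>x. f x / c) \<in> square_integrable M"
  using square_integrable_cmult[of f M "1 / c"] by simp

lemma square_integrable_add:
  assumes "f \<in> square_integrable M" "g \<in> square_integrable M"
  shows "(\<lambda>x. f x + g x) \<in> square_integrable M"
proof -
  have "integrable M (\<lambda>x. (cmod (f x + g x))\<^sup>2)"
  proof (rule Bochner_Integration.integrable_bound)
    show "integrable M (\<lambda>x. 2 * (cmod (f x))\<^sup>2 + 2 * (cmod (g x))\<^sup>2)"
      using assms by (simp add: square_integrable_def)
    show "(\<lambda>x. (cmod (f x + g x))\<^sup>2) \<in> borel_measurable M"
      using assms by (auto dest!: square_integrable_measurable)
    have "(cmod (p + q))\<^sup>2 \<le> 2 * (cmod p)\<^sup>2 + 2 * (cmod q)\<^sup>2" for p q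
      using power_mono[OF norm_triangle_ineq[of p q], of 2] sum_squares_bound[of "cmod p" "cmod q"]
      by (simp add: power2_sum)
    then show "AE x in M. norm ((cmod (f x + g x))\<^sup>2) \<le> norm (2 * (cmod (f x))\<^sup>2 + 2 * (cmod (g x))\<^sup>2)"
      by simp
  qed
  then show ?thesis
    using assms by (auto simp: square_integrable_def)
qed

lemma square_integrable_diff:
  assumes "f \<in> square_integrable M" "g \<in> square_integrable M"
  shows "(\<lambda>x. f x - g x) \<in> square_integrable M"
  using square_integrable_add[OF assms(1) square_integrable_cmult[OF assms(2), of "-1"]] by simp

section \<open>Inner product and norm of the weighted space\<close>

abbreviation bergman_L2 :: "real \<Rightarrow> (complex \<Rightarrow> complex) set" where
  "bergman_L2 \<alpha> \<equiv> square_integrable (bergman_measure \<alpha>)"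

lemma bergman_inner_commute: "cnj (bergman_inner \<alpha> f g) = bergman_inner \<alpha> g f"
proof -
  have "cnj (bergman_inner \<alpha> f g) = (LINT z|bergman_measure \<alpha>. cnj (f z * cnj (g z)))"
    unfolding bergman_inner_def by (rule Bochner_Integration.integral_cnj[symmetric])
  also have "\<dots> = bergman_inner \<alpha> g f"
    by (simp add: bergman_inner_def mult.commute)
  finally show ?thesis .
qed

lemma norm_bergman_inner_commute: "cmod (bergman_inner \<alpha> f g) = cmod (bergman_inner \<alpha> g f)"
  by (metis bergman_inner_commute complex_mod_cnj)

lemma bergman_inner_cmult: "bergman_inner \<alpha> (\<lambda>z. c * f z) g = c * bergman_inner \<alpha> f g"
  by (simp add: bergman_inner_def mult.assoc)

lemma bergman_inner_divide: "bergman_inner \<alpha> (\<lambda>z. f z / c) g = bergman_inner \<alpha> f g / c"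
  using bergman_inner_cmult[of \<alpha> "1 / c" f g] by simp

lemma bergman_inner_add:
  assumes "f \<in> bergman_L2 \<alpha>" "g \<in> bergman_L2 \<alpha>" "h \<in> bergman_L2 \<alpha>"
  shows "bergman_inner \<alpha> (\<lambda>z. f z + g z) h = bergman_inner \<alpha> f h + bergman_inner \<alpha> g h"
  using assms by (simp add: bergman_inner_def distrib_right square_integrable_mult_cnj)

lemma bergman_inner_diff:
  assumes "f \<in> bergman_L2 \<alpha>" "g \<in> bergman_L2 \<alpha>" "h \<in> bergman_L2 \<alpha>"
  shows "bergman_inner \<alpha> (\<lambda>z. f z - g z) h = bergman_inner \<alpha> f h - bergman_inner \<alpha> g h"
  using assms by (simp add: bergman_inner_def left_diff_distrib square_integrable_mult_cnj)

lemma bergman_norm_nonneg: "0 \<le> bergman_norm \<alpha> f"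
  by (simp add: bergman_norm_def)

lemma bergman_norm_power2: "(bergman_norm \<alpha> f)\<^sup>2 = (LINT z|bergman_measure \<alpha>. (cmod (f z))\<^sup>2)"
  by (simp add: bergman_norm_def)

lemma bergman_inner_self: "bergman_inner \<alpha> f f = of_real ((bergman_norm \<alpha> f)\<^sup>2)"
  by (simp add: bergman_norm_power2 bergman_inner_def complex_norm_square[symmetric]
      integral_complex_of_real del: of_real_power)

lemma bergman_norm_cmult: "bergman_norm \<alpha> (\<lambda>z. c * f z) = cmod c * bergman_norm \<alpha> f"
  by (simp add: bergman_norm_def norm_mult power_mult_distrib real_sqrt_mult)

lemma bergman_norm_divide: "bergman_norm \<alpha> (\<lambda>z. f z / c) = bergman_norm \<alpha> f / cmod c"
  using bergman_norm_cmult[of \<alpha> "1 / c" f] by (simp add: norm_divide)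

text \<open>The integral of \<open>(x * cmod (f z) - y * cmod (g z))\<^sup>2\<close> is nonnegative.
  Choosing \<open>x\<close> and \<open>y\<close> slightly above the norms of \<open>g\<close> and
  \<open>f\<close> avoids dividing by a norm that may be zero; the excess then tends to 0.\<close>

lemma bergman_integral_norm_mult_le:
  assumes f: "f \<in> bergman_L2 \<alpha>" and g: "g \<in> bergman_L2 \<alpha>"
  shows "(LINT z|bergman_measure \<alpha>. cmod (f z) * cmod (g z)) \<le> bergman_norm \<alpha> f * bergman_norm \<alpha> g"
    (is "?I \<le> ?F * ?G")
proof (rule field_le_epsilon)
  fix e :: real
  assume "e > 0"
  have quad: "2 * x * y * ?I \<le> x\<^sup>2 * ?F\<^sup>2 + y\<^sup>2 * ?G\<^sup>2" for x y :: real
  proof -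
    have "0 \<le> (LINT z|bergman_measure \<alpha>. (x * cmod (f z) - y * cmod (g z))\<^sup>2)"
      by simp
    also have "\<dots> = (LINT z|bergman_measure \<alpha>. x\<^sup>2 * (cmod (f z))\<^sup>2 + y\<^sup>2 * (cmod (g z))\<^sup>2
        - 2 * x * y * (cmod (f z) * cmod (g z)))"
      by (rule arg_cong[of _ _ "integral\<^sup>L _"]) (auto simp: power2_eq_square algebra_simps)
    also have "\<dots> = x\<^sup>2 * ?F\<^sup>2 + y\<^sup>2 * ?G\<^sup>2 - 2 * x * y * ?I"
      using f g square_integrable_norm_mult[OF f g]
      by (simp add: bergman_norm_power2 square_integrable_def)
    finally show ?thesis by simp
  qed
  \<comment> \<open>Small enough that the error \<open>d * (?F + ?G + d)\<close> of the final
    estimate is at most \<open>e\<close>.\<close>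
  define d where "d = e / (?F + ?G + e + 1)"
  have pos: "?F \<ge> 0" "?G \<ge> 0" by (rule bergman_norm_nonneg)+
  then have d: "d > 0" "d * (?F + ?G + e + 1) = e"
    using \<open>e > 0\<close> by (auto simp: d_def intro!: divide_pos_pos)
  have "d \<le> 1" using \<open>e > 0\<close> pos by (simp add: d_def divide_simps)
  have "2 * ((?F + d) * (?G + d)) * ?I \<le> (?G + d)\<^sup>2 * ?F\<^sup>2 + (?F + d)\<^sup>2 * ?G\<^sup>2"
    using quad[of "?G + d" "?F + d"] by (simp only: mult_ac)
  also have "\<dots> \<le> (?G + d)\<^sup>2 * (?F + d)\<^sup>2 + (?F + d)\<^sup>2 * (?G + d)\<^sup>2"
    using pos d by (intro add_mono mult_left_mono power_mono) auto
  also have "\<dots> = 2 * ((?F + d) * (?G + d)) * ((?F + d) * (?G + d))"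
    by (simp add: power2_eq_square algebra_simps)
  finally have "?I \<le> (?F + d) * (?G + d)"
    using pos d by (subst (asm) mult_le_cancel_left_pos) auto
  also have "\<dots> = ?F * ?G + d * (?F + ?G + d)"
    by (simp add: algebra_simps)
  also have "\<dots> \<le> ?F * ?G + d * (?F + ?G + e + 1)"
    using d \<open>d \<le> 1\<close> \<open>e > 0\<close> by (intro add_left_mono mult_left_mono) auto
  finally show "?I \<le> ?F * ?G + e" using d by simp
qed

lemma bergman_Cauchy_Schwarz:
  assumes f: "f \<in> bergman_L2 \<alpha>" and g: "g \<in> bergman_L2 \<alpha>"
  shows "cmod (bergman_inner \<alpha> f g) \<le> bergman_norm \<alpha> f * bergman_norm \<alpha> g"
proof -
  have "cmod (bergman_inner \<alpha> f g) \<le> (LINT z|bergman_measure \<alpha>. cmod (f z * cnj (g z)))"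
    unfolding bergman_inner_def by (rule integral_norm_bound)
  also have "\<dots> \<le> bergman_norm \<alpha> f * bergman_norm \<alpha> g"
    using bergman_integral_norm_mult_le[OF f g] by (simp add: norm_mult)
  finally show ?thesis .
qed

lemma bergman_norm_add_le:
  assumes f: "f \<in> bergman_L2 \<alpha>" and g: "g \<in> bergman_L2 \<alpha>"
  shows "bergman_norm \<alpha> (\<lambda>z. f z + g z) \<le> bergman_norm \<alpha> f + bergman_norm \<alpha> g"
proof (rule power2_le_imp_le)
  have "(bergman_norm \<alpha> (\<lambda>z. f z + g z))\<^sup>2
      \<le> (LINT z|bergman_measure \<alpha>. (cmod (f z))\<^sup>2 + (cmod (g z))\<^sup>2 + 2 * (cmod (f z) * cmod (g z)))"
    unfolding bergman_norm_power2
  proof (rule integral_mono)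
    show "(cmod (f z + g z))\<^sup>2 \<le> (cmod (f z))\<^sup>2 + (cmod (g z))\<^sup>2 + 2 * (cmod (f z) * cmod (g z))" for z
      using power_mono[OF norm_triangle_ineq[of "f z" "g z"], of 2] by (simp add: power2_sum)
  qed (use square_integrable_add[OF f g] f g square_integrable_norm_mult[OF f g] in
      \<open>simp_all add: square_integrable_def\<close>)
  also have "\<dots> = (bergman_norm \<alpha> f)\<^sup>2 + (bergman_norm \<alpha> g)\<^sup>2
      + 2 * (LINT z|bergman_measure \<alpha>. cmod (f z) * cmod (g z))"
    using f g square_integrable_norm_mult[OF f g]
    by (simp add: bergman_norm_power2 square_integrable_def)
  also have "\<dots> \<le> (bergman_norm \<alpha> f + bergman_norm \<alpha> g)\<^sup>2"
    using bergman_integral_norm_mult_le[OF f g] by (simp add: power2_sum)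
  finally show "(bergman_norm \<alpha> (\<lambda>z. f z + g z))\<^sup>2 \<le> (bergman_norm \<alpha> f + bergman_norm \<alpha> g)\<^sup>2" .
qed (simp add: bergman_norm_nonneg)

lemma abs_bergman_norm_diff_le:
  assumes f: "f \<in> bergman_L2 \<alpha>" and g: "g \<in> bergman_L2 \<alpha>"
  shows "\<bar>bergman_norm \<alpha> f - bergman_norm \<alpha> g\<bar> \<le> bergman_norm \<alpha> (\<lambda>z. f z - g z)"
proof -
  have "bergman_norm \<alpha> f \<le> bergman_norm \<alpha> (\<lambda>z. f z - g z) + bergman_norm \<alpha> g"
    using bergman_norm_add_le[OF square_integrable_diff[OF f g] g] by simp
  moreover have "bergman_norm \<alpha> g \<le> bergman_norm \<alpha> (\<lambda>z. g z - f z) + bergman_norm \<alpha> f"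
    using bergman_norm_add_le[OF square_integrable_diff[OF g f] f] by simp
  moreover have "bergman_norm \<alpha> (\<lambda>z. g z - f z) = bergman_norm \<alpha> (\<lambda>z. f z - g z)"
    by (simp add: bergman_norm_def norm_minus_commute)
  ultimately show ?thesis by linarith
qed

subsection \<open>Orthogonal residuals and the Gram--Schmidt process\<close>

text \<open>A single operation covers what Gram-Schmidt does to its input. One induction then serves
  the square integrable functions, the holomorphic ones, the null vectors and the kernels of linear
  maps.\<close>

definition lin_closed :: "(complex \<Rightarrow> complex) set \<Rightarrow> bool" where
  "lin_closed V \<longleftrightarrow> (\<forall>f\<in>V. \<forall>g\<in>V. \<forall>c. (\<lambda>z. f z - c * g z) \<in> V)"

lemma lin_closedD: "lin_closed V \<Longrightarrow> f \<in> V \<Longrightarrow> g \<in> V \<Longrightarrow> (\<lambda>z. f z - c * g z) \<in> V"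
  by (simp add: lin_closed_def)

text \<open>Division is \<open>f - (1 - 1 / c) * f\<close>. This includes \<open>c = 0\<close>,
  where both sides are the zero function, as happens for a vanishing remainder.\<close>

lemma lin_closed_divide:
  assumes "lin_closed V" "f \<in> V"
  shows "(\<lambda>z. f z / c) \<in> V"
  using lin_closedD[OF assms assms(2), of "1 - 1 / c"] by (simp add: algebra_simps)

lemma lin_closed_sum:
  assumes V: "lin_closed V" and h: "h \<in> V" and g: "\<And>i. i \<in> I \<Longrightarrow> g i \<in> V"
  shows "(\<lambda>z. h z - (\<Sum>i\<in>I. c i * g i z)) \<in> V"
proof (cases "finite I")
  case True
  then show ?thesis
    using g
  proof (induction I)
    case empty
    show ?case using h by simp
  next
    case (insert i I)
    then show ?case
      using lin_closedD[OF V, of "\<lambda>z. h z - (\<Sum>i\<in>I. c i * g i z)" "g i" "c i"]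
      by (simp add: algebra_simps)
  qed
qed (use h in simp)

lemma lin_closed_L2: "lin_closed (square_integrable M)"
  by (simp add: lin_closed_def square_integrable_diff square_integrable_cmult)

text \<open>The remainder before normalization. For a list produced by \<open>gram_schmidt\<close>
  it realizes the projection \<open>P\<close> of the overview.\<close>

definition orth_residual ::
    "real \<Rightarrow> (complex \<Rightarrow> complex) list \<Rightarrow> (complex \<Rightarrow> complex) \<Rightarrow> complex \<Rightarrow> complex" where
  "orth_residual \<alpha> Bs v = (\<lambda>z. v z - (\<Sum>B\<leftarrow>Bs. bergman_inner \<alpha> v B * B z))"

lemma orth_residual_Nil: "orth_residual \<alpha> [] v = v"
  by (simp add: orth_residual_def)

lemma orth_residual_snoc:
  "orth_residual \<alpha> (Bs @ [e]) v = (\<lambda>z. orth_residual \<alpha> Bs v z - bergman_inner \<alpha> v e * e z)"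
  by (simp add: orth_residual_def algebra_simps)

lemma gram_schmidt_step_eq:
  "gram_schmidt_step \<alpha> Bs v =
     (\<lambda>z. orth_residual \<alpha> Bs v z / of_real (bergman_norm \<alpha> (orth_residual \<alpha> Bs v)))"
  by (simp add: gram_schmidt_step_def orth_residual_def)

lemma gram_schmidt_Nil: "gram_schmidt \<alpha> [] = []"
  by (simp add: gram_schmidt_def)

lemma gram_schmidt_snoc:
  "gram_schmidt \<alpha> (vs @ [v]) = gram_schmidt \<alpha> vs @ [gram_schmidt_step \<alpha> (gram_schmidt \<alpha> vs) v]"
  by (simp add: gram_schmidt_def)

lemma orth_residual_closed:
  assumes "lin_closed V" "v \<in> V" "set Bs \<subseteq> V"
  shows "orth_residual \<alpha> Bs v \<in> V"
  using assms(3)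
proof (induction Bs rule: rev_induct)
  case Nil
  show ?case using assms by (simp add: orth_residual_Nil)
next
  case (snoc e Bs)
  then show ?case using assms by (simp add: orth_residual_snoc lin_closedD)
qed

lemma gram_schmidt_closed:
  assumes "lin_closed V" "set vs \<subseteq> V"
  shows "set (gram_schmidt \<alpha> vs) \<subseteq> V"
  using assms(2)
proof (induction vs rule: rev_induct)
  case Nil
  show ?case by (simp add: gram_schmidt_Nil)
next
  case (snoc v vs)
  then show ?case
    using assms
    by (simp add: gram_schmidt_snoc gram_schmidt_step_eq lin_closed_divide orth_residual_closed)
qed

lemmas orth_residual_L2 = orth_residual_closed[OF lin_closed_L2]

lemma orth_residual_diff:
  assumes "v \<in> bergman_L2 \<alpha>" "w \<in> bergman_L2 \<alpha>" "set Bs \<subseteq> bergman_L2 \<alpha>"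
  shows "orth_residual \<alpha> Bs (\<lambda>z. v z - c * w z) =
    (\<lambda>z. orth_residual \<alpha> Bs v z - c * orth_residual \<alpha> Bs w z)"
  using assms(3)
proof (induction Bs rule: rev_induct)
  case Nil
  show ?case by (simp add: orth_residual_Nil)
next
  case (snoc e Bs)
  then show ?case
    using assms
    by (simp add: orth_residual_snoc bergman_inner_diff bergman_inner_cmult square_integrable_cmult
        algebra_simps)
qed

text \<open>Induction on the input list: the new vector is orthogonal to the earlier ones and is
  either of norm one or zero. Both alternatives must be carried along, since linear independence of
  the input is not assumed here.\<close>

lemma gram_schmidt_orthogonal:
  assumes "set vs \<subseteq> bergman_L2 \<alpha>" "w \<in> bergman_L2 \<alpha>" "B \<in> set (gram_schmidt \<alpha> vs)"
  shows "bergman_inner \<alpha> (orth_residual \<alpha> (gram_schmidt \<alpha> vs) w) B = 0"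
  using assms
proof (induction vs arbitrary: w B rule: rev_induct)
  case Nil
  then show ?case by (simp add: gram_schmidt_Nil)
next
  case (snoc v vs)
  define Bs where "Bs = gram_schmidt \<alpha> vs"
  define u where "u = orth_residual \<alpha> Bs v"
  define e where "e = gram_schmidt_step \<alpha> Bs v"
  have Bs: "set Bs \<subseteq> bergman_L2 \<alpha>"
    using gram_schmidt_closed[OF lin_closed_L2] snoc.prems(1) by (auto simp: Bs_def)
  have IH: "bergman_inner \<alpha> (orth_residual \<alpha> Bs w) B = 0" if "w \<in> bergman_L2 \<alpha>" "B \<in> set Bs" for w B
    using snoc that by (simp add: Bs_def)
  have uL: "u \<in> bergman_L2 \<alpha>"
    using snoc.prems Bs by (simp add: u_def orth_residual_L2)
  have e_eq: "e = (\<lambda>z. u z / of_real (bergman_norm \<alpha> u))"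
    by (simp add: e_def u_def gram_schmidt_step_eq)
  have eL: "e \<in> bergman_L2 \<alpha>"
    by (simp add: e_eq square_integrable_divide uL)
  have eB: "bergman_inner \<alpha> e B = 0" if "B \<in> set Bs" for B
    using IH[of v B] that snoc.prems by (simp add: e_eq bergman_inner_divide u_def)
  have Be: "bergman_inner \<alpha> B e = 0" if "B \<in> set Bs" for B
    using eB[OF that] by (subst bergman_inner_commute[symmetric]) simp
  \<comment> \<open>If \<open>u\<close> has norm zero, division by zero makes \<open>e\<close> the
    zero function.\<close>
  have ee: "e = (\<lambda>_. 0) \<or> bergman_inner \<alpha> e e = 1"
    by (cases "bergman_norm \<alpha> u = 0")
       (simp_all add: bergman_inner_self e_eq bergman_norm_divide bergman_norm_nonneg)
  \<comment> \<open>Removing components along vectors orthogonal to \<open>e\<close> does not change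
    the inner product with \<open>e\<close>.\<close>
  have Pe: "bergman_inner \<alpha> (orth_residual \<alpha> Cs w) e = bergman_inner \<alpha> w e"
    if "set Cs \<subseteq> set Bs" for Cs
    using that
  proof (induction Cs rule: rev_induct)
    case Nil
    show ?case by (simp add: orth_residual_Nil)
  next
    case (snoc C Cs)
    then show ?case
      using Bs eL Be \<open>w \<in> bergman_L2 \<alpha>\<close>
      by (subst orth_residual_snoc, subst bergman_inner_diff)
         (auto intro!: orth_residual_L2 square_integrable_cmult simp: bergman_inner_cmult)
  qed
  have "bergman_inner \<alpha> (orth_residual \<alpha> (Bs @ [e]) w) B =
      bergman_inner \<alpha> (orth_residual \<alpha> Bs w) B - bergman_inner \<alpha> w e * bergman_inner \<alpha> e B"
    using snoc.prems Bs eL gram_schmidt_closed[OF lin_closed_L2 snoc.prems(1)]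
    by (subst orth_residual_snoc, subst bergman_inner_diff)
       (auto intro!: orth_residual_L2 square_integrable_cmult simp: bergman_inner_cmult)
  also have "\<dots> = 0"
  proof (cases "B \<in> set Bs")
    case True
    then show ?thesis using IH[OF snoc.prems(2)] eB by simp
  next
    case False
    then have "B = e"
      using snoc.prems(3) by (simp add: gram_schmidt_snoc Bs_def e_def)
    moreover have "bergman_inner \<alpha> w (\<lambda>_. 0) = 0"
      by (simp add: bergman_inner_def)
    ultimately show ?thesis using Pe[of Bs] ee by auto
  qed
  finally show ?case
    by (simp add: gram_schmidt_snoc Bs_def e_def)
qed

lemma bergman_inner_eq_0:
  assumes "f \<in> bergman_L2 \<alpha>" "g \<in> bergman_L2 \<alpha>" "bergman_norm \<alpha> f = 0"
  shows "bergman_inner \<alpha> f g = 0" "bergman_inner \<alpha> g f = 0"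
  using bergman_Cauchy_Schwarz[of f \<alpha> g] bergman_Cauchy_Schwarz[of g \<alpha> f] assms by auto

lemma bergman_norm_eq_if_diff_0:
  assumes "f \<in> bergman_L2 \<alpha>" "g \<in> bergman_L2 \<alpha>" "bergman_norm \<alpha> (\<lambda>z. f z - g z) = 0"
  shows "bergman_norm \<alpha> f = bergman_norm \<alpha> g"
  using abs_bergman_norm_diff_le[of f \<alpha> g] assms by auto

lemma lin_closed_null: "lin_closed {h \<in> bergman_L2 \<alpha>. bergman_norm \<alpha> h = 0}"
  unfolding lin_closed_def
proof (intro ballI allI)
  fix f g c
  assume f: "f \<in> {h \<in> bergman_L2 \<alpha>. bergman_norm \<alpha> h = 0}"
    and g: "g \<in> {h \<in> bergman_L2 \<alpha>. bergman_norm \<alpha> h = 0}"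
  then have "bergman_norm \<alpha> (\<lambda>z. f z + (- c) * g z) \<le> 0"
    using bergman_norm_add_le[of f \<alpha> "\<lambda>z. (- c) * g z"] bergman_norm_cmult[of \<alpha> "- c" g]
      square_integrable_cmult[of g _ "- c"] by simp
  then show "(\<lambda>z. f z - c * g z) \<in> {h \<in> bergman_L2 \<alpha>. bergman_norm \<alpha> h = 0}"
    using f g bergman_norm_nonneg[of \<alpha> "\<lambda>z. f z - c * g z"]
    by (simp add: square_integrable_diff square_integrable_cmult)
qed

text \<open>The kernel of the projection \<open>P\<close>, with vanishing understood in norm rather
  than pointwise.\<close>

definition residual_null :: "real \<Rightarrow> (complex \<Rightarrow> complex) list \<Rightarrow> (complex \<Rightarrow> complex) set" where
  "residual_null \<alpha> Bs = {h \<in> bergman_L2 \<alpha>. bergman_norm \<alpha> (orth_residual \<alpha> Bs h) = 0}"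

lemma lin_closed_residual_null:
  assumes "set Bs \<subseteq> bergman_L2 \<alpha>"
  shows "lin_closed (residual_null \<alpha> Bs)"
  unfolding lin_closed_def
proof (intro ballI allI)
  fix f g c
  assume f: "f \<in> residual_null \<alpha> Bs" and g: "g \<in> residual_null \<alpha> Bs"
  have "(\<lambda>z. orth_residual \<alpha> Bs f z - c * orth_residual \<alpha> Bs g z) \<in>
      {h \<in> bergman_L2 \<alpha>. bergman_norm \<alpha> h = 0}"
    using f g assms by (intro lin_closedD[OF lin_closed_null]) (auto simp: residual_null_def orth_residual_L2)
  then show "(\<lambda>z. f z - c * g z) \<in> residual_null \<alpha> Bs"
    using f g assms
    by (simp add: residual_null_def orth_residual_diff square_integrable_diff square_integrable_cmult)
qed

text \<open>The input vectors lie in the kernel of \<open>P\<close>, even if some remainder was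
  zero. In the induction it suffices that the old residual of \<open>w\<close> is some multiple of
  \<open>e\<close> up to a null function, because the projection coefficient then does as well as
  any other.\<close>

lemma gram_schmidt_residual_null:
  assumes "set vs \<subseteq> bergman_L2 \<alpha>"
  shows "set vs \<subseteq> residual_null \<alpha> (gram_schmidt \<alpha> vs)"
  using assms
proof (induction vs rule: rev_induct)
  case Nil
  show ?case by simp
next
  case (snoc v vs)
  define Bs where "Bs = gram_schmidt \<alpha> vs"
  define u where "u = orth_residual \<alpha> Bs v"
  define e where "e = gram_schmidt_step \<alpha> Bs v"
  have Bs: "set Bs \<subseteq> bergman_L2 \<alpha>"
    using gram_schmidt_closed[OF lin_closed_L2] snoc.prems(1) by (auto simp: Bs_def)
  have vL: "v \<in> bergman_L2 \<alpha>" using snoc.prems by simp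
  have uL: "u \<in> bergman_L2 \<alpha>"
    using vL Bs by (simp add: u_def orth_residual_L2)
  have e_eq: "e = (\<lambda>z. u z / of_real (bergman_norm \<alpha> u))"
    by (simp add: e_def u_def gram_schmidt_step_eq)
  have eL: "e \<in> bergman_L2 \<alpha>"
    by (simp add: e_eq square_integrable_divide uL)
  have e_in: "e \<in> set (gram_schmidt \<alpha> (vs @ [v]))"
    by (simp add: gram_schmidt_snoc Bs_def e_def)
  have new: "orth_residual \<alpha> (gram_schmidt \<alpha> (vs @ [v])) w =
      (\<lambda>z. orth_residual \<alpha> Bs w z - bergman_inner \<alpha> w e * e z)" for w
    by (simp add: gram_schmidt_snoc orth_residual_snoc Bs_def e_def)
  \<comment> \<open>The new residual \<open>R\<close> is orthogonal to \<open>e\<close> and equals a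
    null function plus \<open>d * e\<close>, hence \<open>R\<close> has inner product 0 with
    itself.\<close>
  have contract: "bergman_norm \<alpha> (\<lambda>z. orth_residual \<alpha> Bs w z - bergman_inner \<alpha> w e * e z) = 0"
    if w: "w \<in> bergman_L2 \<alpha>"
      and c: "\<exists>c. bergman_norm \<alpha> (\<lambda>z. orth_residual \<alpha> Bs w z - c * e z) = 0" for w
  proof -
    obtain c where c: "bergman_norm \<alpha> (\<lambda>z. orth_residual \<alpha> Bs w z - c * e z) = 0"
      using c by blast
    define P where "P = orth_residual \<alpha> Bs w"
    have PL: "P \<in> bergman_L2 \<alpha>" using w Bs by (simp add: P_def orth_residual_L2)
    define d where "d = c - bergman_inner \<alpha> w e"
    define R where "R = (\<lambda>z. P z - bergman_inner \<alpha> w e * e z)"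
    have RL: "R \<in> bergman_L2 \<alpha>"
      using PL eL by (simp add: R_def square_integrable_diff square_integrable_cmult)
    have Re: "bergman_inner \<alpha> R e = 0"
      using gram_schmidt_orthogonal[OF snoc.prems w e_in] by (simp add: R_def P_def new)
    have PcL: "(\<lambda>z. P z - c * e z) \<in> bergman_L2 \<alpha>"
      using PL eL by (simp add: square_integrable_diff square_integrable_cmult)
    have "R = (\<lambda>z. (P z - c * e z) + d * e z)"
      by (auto simp: R_def d_def algebra_simps)
    then have "bergman_inner \<alpha> R R = bergman_inner \<alpha> (\<lambda>z. (P z - c * e z) + d * e z) R"
      by simp
    also have "\<dots> = bergman_inner \<alpha> (\<lambda>z. P z - c * e z) R + d * bergman_inner \<alpha> e R"
      using PcL eL RL by (simp add: bergman_inner_add bergman_inner_cmult square_integrable_cmult)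
    also have "bergman_inner \<alpha> (\<lambda>z. P z - c * e z) R = 0"
      using bergman_inner_eq_0(1)[OF PcL RL] c by (simp add: P_def)
    also have "bergman_inner \<alpha> e R = 0"
      using Re by (subst bergman_inner_commute[symmetric]) simp
    finally show ?thesis
      by (simp add: bergman_inner_self R_def P_def)
  qed
  have "bergman_norm \<alpha> (orth_residual \<alpha> (gram_schmidt \<alpha> (vs @ [v])) w) = 0"
    if "w \<in> set (vs @ [v])" for w
  proof (cases "w = v")
    case True
    \<comment> \<open>For the vector just processed the multiple is the norm of \<open>u\<close>. If
      that norm is 0, then \<open>e\<close> is zero and the difference is the null function
      \<open>u\<close> itself.\<close>
    have "bergman_norm \<alpha> (\<lambda>z. u z - of_real (bergman_norm \<alpha> u) * e z) = 0"
      by (cases "bergman_norm \<alpha> u = 0") (simp_all add: e_eq, simp add: bergman_norm_def)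
    then show ?thesis
      using contract[OF vL] True unfolding new u_def by blast
  next
    case False
    then have "w \<in> residual_null \<alpha> Bs"
      using snoc that by (auto simp: Bs_def)
    then have "bergman_norm \<alpha> (\<lambda>z. orth_residual \<alpha> Bs w z - 0 * e z) = 0" "w \<in> bergman_L2 \<alpha>"
      by (simp_all add: residual_null_def)
    then show ?thesis
      using contract[of w] unfolding new by blast
  qed
  then show ?case
    using snoc.prems by (auto simp: residual_null_def)
qed

section \<open>Scaling and limits of the normalized residual\<close>

lemma norm_inner_gram_schmidt_step:
  "cmod (bergman_inner \<alpha> f (gram_schmidt_step \<alpha> Bs v)) =
     cmod (bergman_inner \<alpha> f (orth_residual \<alpha> Bs v)) / bergman_norm \<alpha> (orth_residual \<alpha> Bs v)"
proof -
  have "bergman_inner \<alpha> f (gram_schmidt_step \<alpha> Bs v) =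
      cnj (bergman_inner \<alpha> (gram_schmidt_step \<alpha> Bs v) f)"
    by (simp add: bergman_inner_commute)
  also have "\<dots> = bergman_inner \<alpha> f (orth_residual \<alpha> Bs v) / of_real (bergman_norm \<alpha> (orth_residual \<alpha> Bs v))"
    by (simp add: gram_schmidt_step_eq bergman_inner_divide bergman_inner_commute)
  finally show ?thesis
    by (simp add: norm_divide bergman_norm_nonneg)
qed

text \<open>Up to a null function the residual of \<open>v\<close> is \<open>c\<close> times that of
  \<open>w\<close>, and normalization leaves only a factor of modulus one. This permits replacing a
  kernel by a rescaled copy, or by its remainder after subtracting vectors that \<open>P\<close>
  annihilates.\<close>

lemma norm_inner_gram_schmidt_step_cong:
  assumes f: "f \<in> bergman_L2 \<alpha>" and Bs: "set Bs \<subseteq> bergman_L2 \<alpha>"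
    and v: "v \<in> bergman_L2 \<alpha>" and w: "w \<in> bergman_L2 \<alpha>" and "c \<noteq> 0"
    and null: "(\<lambda>z. v z - c * w z) \<in> residual_null \<alpha> Bs"
  shows "cmod (bergman_inner \<alpha> f (gram_schmidt_step \<alpha> Bs v)) =
    cmod (bergman_inner \<alpha> f (gram_schmidt_step \<alpha> Bs w))"
proof -
  define p q where "p = orth_residual \<alpha> Bs v" and "q = (\<lambda>z. c * orth_residual \<alpha> Bs w z)"
  have L: "p \<in> bergman_L2 \<alpha>" "q \<in> bergman_L2 \<alpha>"
    using v w Bs by (simp_all add: p_def q_def orth_residual_L2 square_integrable_cmult)
  have 0: "bergman_norm \<alpha> (\<lambda>z. p z - q z) = 0"
    using null v w Bs by (simp add: residual_null_def orth_residual_diff p_def q_def)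
  have norm: "bergman_norm \<alpha> p = cmod c * bergman_norm \<alpha> (orth_residual \<alpha> Bs w)"
    using bergman_norm_eq_if_diff_0[OF L 0] by (simp add: q_def bergman_norm_cmult)
  have "bergman_inner \<alpha> p f = bergman_inner \<alpha> q f"
    using bergman_inner_eq_0(1)[OF square_integrable_diff[OF L] f 0] L f
    by (simp add: bergman_inner_diff)
  then have "bergman_inner \<alpha> f p = cnj (bergman_inner \<alpha> q f)"
    by (metis bergman_inner_commute)
  then have "cmod (bergman_inner \<alpha> f p) = cmod c * cmod (bergman_inner \<alpha> f (orth_residual \<alpha> Bs w))"
    unfolding q_def bergman_inner_cmult by (simp add: norm_mult bergman_inner_commute)
  then show ?thesis
    using norm \<open>c \<noteq> 0\<close> by (simp add: norm_inner_gram_schmidt_step p_def)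
qed

text \<open>By Cauchy-Schwarz each subtracted component costs at most the square of the norm of
  \<open>e\<close>. The resulting crude constant suffices for continuity.\<close>

lemma norm_orth_residual_le:
  assumes "set Bs \<subseteq> bergman_L2 \<alpha>"
  shows "\<exists>C\<ge>0. \<forall>v\<in>bergman_L2 \<alpha>. bergman_norm \<alpha> (orth_residual \<alpha> Bs v) \<le> C * bergman_norm \<alpha> v"
  using assms
proof (induction Bs rule: rev_induct)
  case Nil
  show ?case by (intro exI[of _ 1]) (simp add: orth_residual_Nil)
next
  case (snoc e Bs)
  then obtain C where C: "C \<ge> 0"
    "\<And>v. v \<in> bergman_L2 \<alpha> \<Longrightarrow> bergman_norm \<alpha> (orth_residual \<alpha> Bs v) \<le> C * bergman_norm \<alpha> v"
    by auto
  have "bergman_norm \<alpha> (orth_residual \<alpha> (Bs @ [e]) v) \<le> (C + (bergman_norm \<alpha> e)\<^sup>2) * bergman_norm \<alpha> v"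
    if v: "v \<in> bergman_L2 \<alpha>" for v
  proof -
    let ?p = "orth_residual \<alpha> Bs v" and ?c = "bergman_inner \<alpha> v e"
    have "bergman_norm \<alpha> (\<lambda>z. ?p z + - ?c * e z) \<le> bergman_norm \<alpha> ?p + bergman_norm \<alpha> (\<lambda>z. - ?c * e z)"
      using snoc.prems v by (intro bergman_norm_add_le square_integrable_cmult orth_residual_L2) auto
    also have "\<dots> \<le> C * bergman_norm \<alpha> v + (bergman_norm \<alpha> v * bergman_norm \<alpha> e) * bergman_norm \<alpha> e"
      unfolding bergman_norm_cmult norm_minus_cancel
      using snoc.prems v C bergman_norm_nonneg[of \<alpha> e]
      by (intro add_mono mult_right_mono bergman_Cauchy_Schwarz) auto
    finally show ?thesis
      by (simp add: orth_residual_snoc algebra_simps power2_eq_square)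
  qed
  then show ?case using C(1) by (intro exI[of _ "C + (bergman_norm \<alpha> e)\<^sup>2"]) auto
qed

text \<open>Boundedness of \<open>P\<close> gives convergence of the numerator and of the
  denominator in \<open>norm_inner_gram_schmidt_step\<close>; the quotient converges since the limit
  of the denominator is nonzero.\<close>

lemma tendsto_gram_schmidt_step:
  assumes f: "f \<in> bergman_L2 \<alpha>" and Bs: "set Bs \<subseteq> bergman_L2 \<alpha>"
    and v: "v \<in> bergman_L2 \<alpha>" and w: "\<forall>\<^sub>F x in F. w x \<in> bergman_L2 \<alpha>"
    and nz: "bergman_norm \<alpha> (orth_residual \<alpha> Bs v) \<noteq> 0"
    and lim: "((\<lambda>x. bergman_norm \<alpha> (\<lambda>z. w x z - v z)) \<longlongrightarrow> 0) F"
  shows "((\<lambda>x. cmod (bergman_inner \<alpha> f (gram_schmidt_step \<alpha> Bs (w x)))) \<longlongrightarrow>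
    cmod (bergman_inner \<alpha> f (gram_schmidt_step \<alpha> Bs v))) F"
proof -
  define P where "P = orth_residual \<alpha> Bs"
  obtain C where C: "\<And>u. u \<in> bergman_L2 \<alpha> \<Longrightarrow> bergman_norm \<alpha> (P u) \<le> C * bergman_norm \<alpha> u"
    using norm_orth_residual_le[OF Bs] by (auto simp: P_def)
  have diff: "P (\<lambda>z. u z - v z) = (\<lambda>z. P u z - P v z)" if "u \<in> bergman_L2 \<alpha>" for u
    using orth_residual_diff[OF that v Bs, of 1] by (simp add: P_def)
  have PL: "P u \<in> bergman_L2 \<alpha>" if "u \<in> bergman_L2 \<alpha>" for u
    using that Bs by (simp add: P_def orth_residual_L2)
  have limP: "((\<lambda>x. C * bergman_norm \<alpha> (\<lambda>z. w x z - v z)) \<longlongrightarrow> 0) F"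
    using tendsto_mult_right_zero[OF lim] .
  have "((\<lambda>x. bergman_norm \<alpha> (P (w x)) - bergman_norm \<alpha> (P v)) \<longlongrightarrow> 0) F"
    using w
  proof (rule Lim_null_comparison[OF eventually_mono limP])
    fix x assume x: "w x \<in> bergman_L2 \<alpha>"
    show "norm (bergman_norm \<alpha> (P (w x)) - bergman_norm \<alpha> (P v)) \<le> C * bergman_norm \<alpha> (\<lambda>z. w x z - v z)"
      using abs_bergman_norm_diff_le[OF PL[OF x] PL[OF v]] C[OF square_integrable_diff[OF x v]]
      by (simp add: diff[OF x])
  qed
  then have 1: "((\<lambda>x. bergman_norm \<alpha> (P (w x))) \<longlongrightarrow> bergman_norm \<alpha> (P v)) F"
    by (rule LIM_zero_cancel)
  have "((\<lambda>x. bergman_inner \<alpha> (P (w x)) f - bergman_inner \<alpha> (P v) f) \<longlongrightarrow> 0) F"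
    using w
  proof (rule Lim_null_comparison[OF eventually_mono])
    show "((\<lambda>x. C * bergman_norm \<alpha> (\<lambda>z. w x z - v z) * bergman_norm \<alpha> f) \<longlongrightarrow> 0) F"
      using tendsto_mult_left_zero[OF limP] .
    fix x assume x: "w x \<in> bergman_L2 \<alpha>"
    have "cmod (bergman_inner \<alpha> (P (w x)) f - bergman_inner \<alpha> (P v) f) =
        cmod (bergman_inner \<alpha> (\<lambda>z. P (w x) z - P v z) f)"
      using PL[OF x] PL[OF v] f by (simp add: bergman_inner_diff)
    also have "\<dots> \<le> bergman_norm \<alpha> (\<lambda>z. P (w x) z - P v z) * bergman_norm \<alpha> f"
      using PL[OF x] PL[OF v] f by (intro bergman_Cauchy_Schwarz square_integrable_diff)
    also have "\<dots> \<le> C * bergman_norm \<alpha> (\<lambda>z. w x z - v z) * bergman_norm \<alpha> f"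
      using C[OF square_integrable_diff[OF x v]] bergman_norm_nonneg
      by (intro mult_right_mono) (simp_all add: diff[OF x])
    finally show "cmod (bergman_inner \<alpha> (P (w x)) f - bergman_inner \<alpha> (P v) f)
        \<le> C * bergman_norm \<alpha> (\<lambda>z. w x z - v z) * bergman_norm \<alpha> f" .
  qed
  then have "((\<lambda>x. bergman_inner \<alpha> (P (w x)) f) \<longlongrightarrow> bergman_inner \<alpha> (P v) f) F"
    by (rule LIM_zero_cancel)
  then have 2: "((\<lambda>x. cmod (bergman_inner \<alpha> f (P (w x)))) \<longlongrightarrow> cmod (bergman_inner \<alpha> f (P v))) F"
    unfolding norm_bergman_inner_commute[of \<alpha> f] by (rule tendsto_norm)
  show ?thesis
    using tendsto_divide[OF 2 1] nz by (simp add: norm_inner_gram_schmidt_step P_def)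
qed

text \<open>\<open>P\<close> differs from the identity by finitely many terms, each of which tends
  to 0 in norm along a weakly null family. So the residuals of unit vectors have norms tending to 1,
  while their inner products with \<open>f\<close> tend to 0.\<close>

lemma tendsto_gram_schmidt_step_weak:
  assumes Bs: "set Bs \<subseteq> bergman_L2 \<alpha>" and f: "f \<in> bergman_L2 \<alpha>"
    and w: "\<forall>\<^sub>F x in F. w x \<in> bergman_L2 \<alpha> \<and> bergman_norm \<alpha> (w x) = 1"
    and weak: "\<And>g. g \<in> bergman_L2 \<alpha> \<Longrightarrow> ((\<lambda>x. bergman_inner \<alpha> (w x) g) \<longlongrightarrow> 0) F"
  shows "((\<lambda>x. cmod (bergman_inner \<alpha> f (gram_schmidt_step \<alpha> Bs (w x)))) \<longlongrightarrow> 0) F"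
proof -
  have "((\<lambda>x. bergman_inner \<alpha> (orth_residual \<alpha> Bs (w x)) f) \<longlongrightarrow> 0) F \<and>
     ((\<lambda>x. bergman_norm \<alpha> (orth_residual \<alpha> Bs (w x))) \<longlongrightarrow> 1) F"
    using Bs
  proof (induction Bs rule: rev_induct)
    case Nil
    have "((\<lambda>x. bergman_norm \<alpha> (w x)) \<longlongrightarrow> 1) F"
      by (rule tendsto_eventually) (use w in eventually_elim, simp)
    then show ?case using weak[OF f] by (simp add: orth_residual_Nil)
  next
    case (snoc e Bs)
    define P where "P = orth_residual \<alpha> Bs"
    have e: "e \<in> bergman_L2 \<alpha>" and Bs: "set Bs \<subseteq> bergman_L2 \<alpha>" using snoc.prems by auto
    have PL: "P u \<in> bergman_L2 \<alpha>" if "u \<in> bergman_L2 \<alpha>" for u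
      using that Bs by (simp add: P_def orth_residual_L2)
    have 1: "((\<lambda>x. bergman_inner \<alpha> (P (w x)) f - bergman_inner \<alpha> (w x) e * bergman_inner \<alpha> e f) \<longlongrightarrow> 0) F"
      using tendsto_diff[OF _ tendsto_mult_left_zero[OF weak[OF e]]] snoc by (force simp: P_def)
    \<comment> \<open>By the reverse triangle inequality, the norm changes by at most the norm of
      the newly subtracted component.\<close>
    have 2: "((\<lambda>x. bergman_norm \<alpha> (orth_residual \<alpha> (Bs @ [e]) (w x)) - bergman_norm \<alpha> (P (w x))) \<longlongrightarrow> 0) F"
      using w
    proof (rule Lim_null_comparison[OF eventually_mono])
      show "((\<lambda>x. cmod (bergman_inner \<alpha> (w x) e) * bergman_norm \<alpha> e) \<longlongrightarrow> 0) F"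
        using tendsto_mult_left_zero[OF tendsto_norm_zero[OF weak[OF e]]] .
      fix x assume "w x \<in> bergman_L2 \<alpha> \<and> bergman_norm \<alpha> (w x) = 1"
      then have x: "P (w x) \<in> bergman_L2 \<alpha>" by (simp add: PL)
      let ?h = "\<lambda>z. P (w x) z - bergman_inner \<alpha> (w x) e * e z"
      have "\<bar>bergman_norm \<alpha> ?h - bergman_norm \<alpha> (P (w x))\<bar> \<le> bergman_norm \<alpha> (\<lambda>z. ?h z - P (w x) z)"
        using x e by (intro abs_bergman_norm_diff_le square_integrable_diff square_integrable_cmult)
      also have "\<dots> = cmod (bergman_inner \<alpha> (w x) e) * bergman_norm \<alpha> e"
        using bergman_norm_cmult[of \<alpha> "- bergman_inner \<alpha> (w x) e" e] by simp
      finally show "norm (bergman_norm \<alpha> (orth_residual \<alpha> (Bs @ [e]) (w x)) - bergman_norm \<alpha> (P (w x)))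
          \<le> cmod (bergman_inner \<alpha> (w x) e) * bergman_norm \<alpha> e"
        by (simp add: orth_residual_snoc P_def)
    qed
    have "((\<lambda>x. bergman_norm \<alpha> (orth_residual \<alpha> (Bs @ [e]) (w x))) \<longlongrightarrow> 1) F"
      using tendsto_add[OF 2, of "\<lambda>x. bergman_norm \<alpha> (P (w x))" 1] snoc by (simp add: P_def)
    moreover have "((\<lambda>x. bergman_inner \<alpha> (orth_residual \<alpha> (Bs @ [e]) (w x)) f) \<longlongrightarrow> 0) F"
      using 1
    proof (rule Lim_transform_eventually)
      show "\<forall>\<^sub>F x in F. bergman_inner \<alpha> (P (w x)) f - bergman_inner \<alpha> (w x) e * bergman_inner \<alpha> e f =
          bergman_inner \<alpha> (orth_residual \<alpha> (Bs @ [e]) (w x)) f"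
        using w
        by eventually_elim
           (use PL e f in \<open>simp add: P_def orth_residual_snoc bergman_inner_diff bergman_inner_cmult
              square_integrable_cmult\<close>)
    qed
    ultimately show ?case by simp
  qed
  then have "((\<lambda>x. cmod (bergman_inner \<alpha> f (orth_residual \<alpha> Bs (w x))) /
      bergman_norm \<alpha> (orth_residual \<alpha> Bs (w x))) \<longlongrightarrow> 0 / 1) F"
    unfolding norm_bergman_inner_commute[of \<alpha> f]
    by (intro tendsto_divide) (auto intro: tendsto_norm_zero)
  then show ?thesis by (simp add: norm_inner_gram_schmidt_step)
qed

subsection \<open>The weighted area measure\<close>

text \<open>The hypotheses say that \<open>ln x\<close> has absolute value at most
  \<open>ln c\<close>. This form treats positive and negative exponents at once.\<close>

lemma powr_between:
  fixes x c :: real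
  assumes "0 < c" "1 / c \<le> x" "x \<le> c"
  shows "c powr (- \<bar>a\<bar>) \<le> x powr a" "x powr a \<le> c powr \<bar>a\<bar>"
proof -
  have x: "0 < x" using assms by (meson divide_pos_pos less_le_trans zero_less_one)
  have "- ln c \<le> ln x" "ln x \<le> ln c"
    using assms x ln_le_cancel_iff[of "1 / c" x] by (simp_all add: ln_div)
  then have "\<bar>a * ln x\<bar> \<le> \<bar>a\<bar> * ln c"
    unfolding abs_mult by (intro mult_left_mono) auto
  then show "c powr (- \<bar>a\<bar>) \<le> x powr a" "x powr a \<le> c powr \<bar>a\<bar>"
    using x assms by (auto simp: powr_def)
qed

lemma space_bergman_measure: "space (bergman_measure \<alpha>) = ball 0 1"
  by (simp add: bergman_measure_def space_restrict_space)

lemma sets_bergman_measure: "sets (bergman_measure \<alpha>) = sets (restrict_space borel (ball 0 1))"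
  unfolding bergman_measure_def sets_density by (rule sets_restrict_space_cong) (rule sets_lborel)

lemma bergman_weight_measurable:
  "(\<lambda>z. ennreal ((1 + \<alpha>) * (1 - (cmod z)\<^sup>2) powr \<alpha> / pi))
     \<in> borel_measurable (restrict_space lborel (ball 0 1))"
  by (intro measurable_restrict_space1) measurable

lemma emeasure_bergman_measure:
  assumes "A \<in> sets borel" "A \<subseteq> ball 0 1"
  shows "emeasure (bergman_measure \<alpha>) A =
    (\<integral>\<^sup>+ z. ennreal ((1 + \<alpha>) * (1 - (cmod z)\<^sup>2) powr \<alpha> / pi) * indicator A z \<partial>lborel)"
proof -
  have "A \<in> sets (restrict_space lborel (ball 0 1))"
    using assms by (subst sets_restrict_space_iff) auto
  then have "emeasure (bergman_measure \<alpha>) A =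
      (\<integral>\<^sup>+ z. ennreal ((1 + \<alpha>) * (1 - (cmod z)\<^sup>2) powr \<alpha> / pi) * indicator A z \<partial>restrict_space lborel (ball 0 1))"
    unfolding bergman_measure_def by (rule emeasure_density[OF bergman_weight_measurable])
  also have "\<dots> = (\<integral>\<^sup>+ z. ennreal ((1 + \<alpha>) * (1 - (cmod z)\<^sup>2) powr \<alpha> / pi) * indicator A z * indicator (ball 0 1) z \<partial>lborel)"
    by (rule nn_integral_restrict_space) simp
  also have "\<dots> = (\<integral>\<^sup>+ z. ennreal ((1 + \<alpha>) * (1 - (cmod z)\<^sup>2) powr \<alpha> / pi) * indicator A z \<partial>lborel)"
    using assms(2) by (intro nn_integral_cong) (auto simp: indicator_def)
  finally show ?thesis .
qed

lemma emeasure_lborel_complex_ball: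
  "r \<ge> 0 \<Longrightarrow> emeasure lborel (ball (c :: complex) r) = ennreal (pi * r\<^sup>2)"
  by (simp add: emeasure_ball unit_ball_vol_2)

text \<open>The annulus \<open>A n\<close> consists of the points of the disc with
  \<open>1 - (cmod z)\<^sup>2 \<le> (1/2) ^ n\<close>. The weight is dominated by a sum of multiples
  of indicators of these annuli, whose integral is a geometric series.\<close>

lemma finite_measure_bergman_measure:
  assumes "-1 < \<alpha>"
  shows "finite_measure (bergman_measure \<alpha>)"
proof (rule finite_measureI)
  define A :: "nat \<Rightarrow> complex set" where "A n = ball 0 1 - ball 0 (sqrt (1 - (1/2) ^ n))" for n
  define C where "C n = (1 + \<alpha>) / pi * (2 powr \<bar>\<alpha>\<bar> * ((1/2) ^ n) powr \<alpha>)" for n :: nat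
  have [measurable]: "A n \<in> sets borel" for n
    by (simp add: A_def)
  have C0: "C n \<ge> 0" for n
    using assms by (simp add: C_def)
  have emA: "emeasure lborel (A n) = ennreal (pi * (1/2) ^ n)" for n
  proof -
    have "(1/2 :: real) ^ n \<le> 1" by (simp add: power_le_one)
    then have "emeasure lborel (A n) = ennreal pi - ennreal (pi * (1 - (1/2) ^ n))"
      unfolding A_def
      by (subst emeasure_Diff) (simp_all add: emeasure_lborel_complex_ball subset_ball)
    also have "\<dots> = ennreal (pi - pi * (1 - (1/2) ^ n))"
      using \<open>(1/2) ^ n \<le> 1\<close> by (intro ennreal_minus) simp
    also have "pi - pi * (1 - (1/2) ^ n) = pi * (1/2) ^ n"
      by (simp add: right_diff_distrib)
    finally show ?thesis .
  qed
  have le_suminf: "f n \<le> suminf f" for f :: "nat \<Rightarrow> ennreal" and n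
    using sum_le_suminf[of f "{n}"] by simp
  have bound: "ennreal ((1 + \<alpha>) * (1 - (cmod z)\<^sup>2) powr \<alpha> / pi) * indicator (ball 0 1) z
      \<le> (\<Sum>n. ennreal (C n) * indicator (A n) z)" for z
  proof (cases "z \<in> ball 0 1")
    case True
    define t where "t = 1 - (cmod z)\<^sup>2"
    have t: "0 < t" "t \<le> 1"
      using True by (simp_all add: t_def abs_square_less_1)
    \<comment> \<open>The dyadic level of \<open>z\<close>: by minimality, or by
      \<open>t \<le> 1\<close> when \<open>n = 0\<close>, the number \<open>t\<close> equals
      \<open>(1/2) ^ n\<close> up to a factor of at most 2.\<close>
    define n where "n = (LEAST n. (1/2) ^ Suc n < t)"
    obtain m where "(1/2) ^ m < t"
      using real_arch_pow_inv[OF t(1), of "1/2"] by auto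
    then have "(1/2) ^ Suc m < t"
      by (rule le_less_trans[rotated]) simp
    then have n1: "(1/2) ^ Suc n < t"
      unfolding n_def by (rule LeastI)
    have n2: "t \<le> (1/2) ^ n"
    proof (cases n)
      case (Suc m)
      then have "\<not> (1/2) ^ Suc m < t"
        using not_less_Least[of m "\<lambda>n. (1/2) ^ Suc n < t"] by (simp add: n_def)
      then show ?thesis using Suc by simp
    qed (use t in simp)
    define y where "y = t / (1/2) ^ n"
    have y: "1 / 2 \<le> y" "y \<le> 2" "t = (1/2) ^ n * y" "0 < y"
      using n1 n2 t by (auto simp: y_def field_simps)
    have "t powr \<alpha> = ((1/2) ^ n) powr \<alpha> * y powr \<alpha>"
      using y by (simp add: powr_mult)
    also have "\<dots> \<le> ((1/2) ^ n) powr \<alpha> * 2 powr \<bar>\<alpha>\<bar>"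
      using y by (intro mult_left_mono powr_between) auto
    finally have "(1 + \<alpha>) / pi * t powr \<alpha> \<le> C n"
      using assms unfolding C_def by (intro mult_left_mono) (auto simp: mult.commute)
    moreover have "sqrt (1 - (1/2) ^ n) \<le> cmod z"
      using n2 by (intro real_le_lsqrt) (simp_all add: t_def)
    then have "z \<in> A n"
      using True by (simp add: A_def)
    ultimately have "ennreal ((1 + \<alpha>) * (1 - (cmod z)\<^sup>2) powr \<alpha> / pi) * indicator (ball 0 1) z
        \<le> ennreal (C n) * indicator (A n) z"
      using True by (simp add: t_def ennreal_leI)
    also have "\<dots> \<le> (\<Sum>n. ennreal (C n) * indicator (A n) z)"
      by (rule le_suminf)
    finally show ?thesis .
  qed simp
  \<comment> \<open>Each level multiplies the bound on the weight by
    \<open>(1/2) powr \<alpha>\<close> and the area by \<open>1/2\<close>. The product is below 1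
    because \<open>\<alpha> > -1\<close>.\<close>
  define q where "q = (1/2) powr (1 + \<alpha>)"
  have q: "0 \<le> q" "q < 1"
    using assms by (simp_all add: q_def powr_def ln_div)
  have "emeasure (bergman_measure \<alpha>) (ball 0 1) \<le> (\<integral>\<^sup>+ z. (\<Sum>n. ennreal (C n) * indicator (A n) z) \<partial>lborel)"
    by (subst emeasure_bergman_measure) (auto intro!: nn_integral_mono bound)
  also have "\<dots> = (\<Sum>n. \<integral>\<^sup>+ z. ennreal (C n) * indicator (A n) z \<partial>lborel)"
    by (rule nn_integral_suminf) measurable
  also have "\<dots> = (\<Sum>n. ennreal (C n * (pi * (1/2) ^ n)))"
    using C0 by (simp add: nn_integral_cmult_indicator emA ennreal_mult)
  also have "(\<lambda>n. C n * (pi * (1/2) ^ n)) = (\<lambda>n. (1 + \<alpha>) * 2 powr \<bar>\<alpha>\<bar> * q ^ n)"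
  proof
    fix n
    have "((1/2) ^ n) powr \<alpha> * (1/2) ^ n = ((1/2) ^ n) powr (1 + \<alpha>)"
      by (simp add: powr_add)
    also have "\<dots> = q ^ n"
      by (simp add: q_def powr_power powr_realpow[symmetric] powr_powr mult.commute)
    finally show "C n * (pi * (1/2) ^ n) = (1 + \<alpha>) * 2 powr \<bar>\<alpha>\<bar> * q ^ n"
      by (simp add: C_def)
  qed
  finally have "emeasure (bergman_measure \<alpha>) (ball 0 1) \<le>
      (\<Sum>n. ennreal ((1 + \<alpha>) * 2 powr \<bar>\<alpha>\<bar> * q ^ n))" .
  moreover have "(\<Sum>n. ennreal ((1 + \<alpha>) * 2 powr \<bar>\<alpha>\<bar> * q ^ n)) \<noteq> top"
    using assms q by (intro ennreal_suminf_neq_top summable_mult summable_geometric) auto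
  ultimately show "emeasure (bergman_measure \<alpha>) (space (bergman_measure \<alpha>)) \<noteq> \<infinity>"
    by (auto simp: space_bergman_measure top_unique)
qed

lemma continuous_on_imp_bergman_measurable:
  fixes f :: "complex \<Rightarrow> 'a :: topological_space"
  assumes "continuous_on (ball 0 1) f"
  shows "f \<in> borel_measurable (bergman_measure \<alpha>)"
  using borel_measurable_continuous_on_restrict[OF assms]
  by (simp add: measurable_cong_sets[OF sets_bergman_measure refl])

lemma bergman_space_subset_L2: "bergman_space \<alpha> \<subseteq> bergman_L2 \<alpha>"
  using continuous_on_imp_bergman_measurable[OF holomorphic_on_imp_continuous_on]
  by (simp add: subset_iff bergman_space_def square_integrable_def)

lemma bounded_continuous_in_L2:
  assumes "-1 < \<alpha>" "continuous_on (ball 0 1) f" "\<And>z. z \<in> ball 0 1 \<Longrightarrow> cmod (f z) \<le> B"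
  shows "f \<in> bergman_L2 \<alpha>"
proof -
  interpret finite_measure "bergman_measure \<alpha>"
    by (rule finite_measure_bergman_measure) fact
  have f: "f \<in> borel_measurable (bergman_measure \<alpha>)"
    by (rule continuous_on_imp_bergman_measurable) fact
  have "(cmod (f z))\<^sup>2 \<le> B\<^sup>2" if "z \<in> ball 0 1" for z
    using assms(3)[OF that] by (simp add: power_mono)
  then have "integrable (bergman_measure \<alpha>) (\<lambda>z. (cmod (f z))\<^sup>2)"
    using f by (intro integrable_const_bound[of _ "B\<^sup>2"]) (auto simp: space_bergman_measure)
  then show ?thesis using f by (simp add: square_integrable_def)
qed

lemma bergman_norm_le_bound:
  assumes "-1 < \<alpha>" "f \<in> bergman_L2 \<alpha>" "\<And>z. z \<in> ball 0 1 \<Longrightarrow> cmod (f z) \<le> B" "B \<ge> 0"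
  shows "bergman_norm \<alpha> f \<le> B * sqrt (measure (bergman_measure \<alpha>) (ball 0 1))"
proof -
  interpret finite_measure "bergman_measure \<alpha>"
    by (rule finite_measure_bergman_measure) fact
  have "(LINT z|bergman_measure \<alpha>. (cmod (f z))\<^sup>2) \<le> (LINT z|bergman_measure \<alpha>. B\<^sup>2)"
    using assms by (intro integral_mono) (auto simp: square_integrable_def space_bergman_measure power_mono)
  then have "bergman_norm \<alpha> f \<le> sqrt (B\<^sup>2 * measure (bergman_measure \<alpha>) (ball 0 1))"
    by (simp add: bergman_norm_def space_bergman_measure mult.commute)
  then show ?thesis using assms(4) by (simp add: real_sqrt_mult)
qed

text \<open>The weight is positive on the disc, so \<open>h\<close> vanishes almost everywhere for
  Lebesgue measure; by continuity its nonzero set is open, and an open null set is empty.\<close>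

lemma bergman_norm_0_imp_0:
  assumes "-1 < \<alpha>" "h \<in> bergman_L2 \<alpha>" "continuous_on (ball 0 1) h" "bergman_norm \<alpha> h = 0" "z \<in> ball 0 1"
  shows "h z = 0"
proof (rule ccontr)
  assume nz: "h z \<noteq> 0"
  define S where "S = {w \<in> ball 0 1. h w \<noteq> 0}"
  have "open S"
    using continuous_open_preimage[OF assms(3) open_ball, of "- {0}"]
    by (simp add: S_def vimage_def Int_def open_Compl)
  have "(LINT z|bergman_measure \<alpha>. (cmod (h z))\<^sup>2) = 0"
    using assms(4) by (simp add: bergman_norm_def)
  then have "AE z in bergman_measure \<alpha>. h z = 0"
    using assms(2) by (subst (asm) integral_nonneg_eq_0_iff_AE) (auto simp: square_integrable_def)
  then have "AE z in lborel. z \<in> ball 0 1 \<longrightarrow> h z = 0"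
    unfolding bergman_measure_def AE_density[OF bergman_weight_measurable]
  proof (subst (asm) AE_restrict_space_iff)
    assume "AE z in lborel. z \<in> ball 0 1 \<longrightarrow> 0 < ennreal ((1 + \<alpha>) * (1 - (cmod z)\<^sup>2) powr \<alpha> / pi) \<longrightarrow> h z = 0"
    then show ?thesis
    proof eventually_elim
      case (elim z)
      have "(1 + \<alpha>) * (1 - (cmod z)\<^sup>2) powr \<alpha> / pi > 0" if "z \<in> ball 0 1"
        using that abs_square_less_1[of "cmod z"] assms(1) by simp
      then show ?case using elim by simp
    qed
  qed simp
  \<comment> \<open>Phrased with the closed set \<open>{}\<close>, so that almost everywhere
    membership on the open set \<open>S\<close> upgrades to membership everywhere.\<close>
  then have "AE w in lebesgue. w \<in> S \<longrightarrow> w \<in> {}"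
    by (intro AE_completion) (simp add: S_def)
  then show False
    using mem_closed_if_AE_lebesgue_open[OF \<open>open S\<close> closed_empty, of z] nz assms(5)
    by (simp add: S_def)
qed

section \<open>Bounds and holomorphy of the kernels\<close>

lemma norm_kernel_deriv_le:
  assumes "0 < s" "cmod u < 1" "cmod z < 1"
  shows "cmod (kernel_deriv s i u z) \<le>
    cmod (pochhammer (of_real s) i) * (1 - cmod u) powr (- (s + real i))"
proof -
  have "1 - cmod u \<le> 1 - cmod (u * z)"
    using assms by (simp add: norm_mult mult_left_le)
  also have "\<dots> \<le> cmod (1 - u * z)"
    using norm_triangle_ineq2[of 1 "u * z"] by simp
  finally have "cmod (1 - u * z) powr (- (s + real i)) \<le> (1 - cmod u) powr (- (s + real i))"
    using assms by (intro powr_mono2') auto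
  moreover have "cmod ((1 - u * z) powr (- (of_real s + of_nat i))) = cmod (1 - u * z) powr (- (s + real i))"
    by (subst norm_powr_real_powr') auto
  moreover have "cmod z ^ i \<le> 1"
    using assms by (simp add: power_le_one)
  ultimately show ?thesis
    unfolding kernel_deriv_def norm_mult norm_power mult.assoc
    using mult_mono[of "cmod z ^ i" 1 "cmod (1 - u * z) powr (- (s + real i))"]
    by (intro mult_left_mono) simp_all
qed

lemma holomorphic_kernel_deriv:
  assumes "cmod u \<le> 1"
  shows "kernel_deriv s i u holomorphic_on ball 0 1"
proof -
  have "1 - u * z \<notin> \<real>\<^sub>\<le>\<^sub>0" if "z \<in> ball 0 1" for z
    using Re_one_minus_pos[OF assms, of z] that by (auto simp: complex_nonpos_Reals_iff)
  then show ?thesis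
    unfolding kernel_deriv_def[abs_def] by (intro holomorphic_intros) auto
qed

lemma kernel_deriv_in_L2:
  assumes "-1 < \<alpha>" "0 < s" "cmod u < 1"
  shows "kernel_deriv s i u \<in> bergman_L2 \<alpha>"
proof (rule bounded_continuous_in_L2)
  show "continuous_on (ball 0 1) (kernel_deriv s i u)"
    using assms by (intro holomorphic_on_imp_continuous_on holomorphic_kernel_deriv) simp
  show "cmod (kernel_deriv s i u z) \<le> cmod (pochhammer (of_real s) i) * (1 - cmod u) powr (- (s + real i))"
    if "z \<in> ball 0 1" for z
    using assms that by (intro norm_kernel_deriv_le) simp_all
qed fact

subsection \<open>Linear independence of the generalized kernels\<close>

text \<open>The kernel expands as the sum of \<open>pochhammer s n * (u * z) ^ n / fact n\<close>;
  differentiating \<open>i\<close> times in \<open>u\<close> acts only on the monomial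
  \<open>u ^ n\<close>. The proof reads this off the binomial series for the shifted
  exponent.\<close>

lemma higher_deriv_kernel_deriv:
  "(deriv ^^ n) (kernel_deriv s i u) 0 =
     pochhammer (of_real s) n * poly ((pderiv ^^ i) (monom 1 n)) u"
proof -
  define c where "c = - (complex_of_real s + of_nat i)"
  define F where "F = fps_const (pochhammer (of_real s) i) *
    (fps_X ^ i * (fps_binomial c oo (fps_const (- u) * fps_X)))"
  have "((\<lambda>x. (1 + x) powr c) \<circ> (\<lambda>z. - u * z)) has_fps_expansion
      (fps_binomial c oo (fps_const (- u) * fps_X))"
  proof (rule has_fps_expansion_compose[OF has_fps_expansion_binomial_complex])
    show "(\<lambda>z. - u * z) has_fps_expansion fps_const (- u) * fps_X"
      by (intro fps_expansion_intros)
  qed simp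
  then have "(\<lambda>z. pochhammer (of_real s) i * (z ^ i * ((\<lambda>x. (1 + x) powr c) \<circ> (\<lambda>z. - u * z)) z))
      has_fps_expansion F"
    unfolding F_def by (intro fps_expansion_intros) simp
  then have "kernel_deriv s i u has_fps_expansion F"
    by (simp add: kernel_deriv_def[abs_def] c_def o_def mult.assoc)
  from fps_nth_fps_expansion[OF this, of n]
  have eq: "(deriv ^^ n) (kernel_deriv s i u) 0 = fact n * fps_nth F n"
    by simp
  show ?thesis
  proof (cases "n < i")
    case True
    then have "(pderiv ^^ i) (monom (1 :: complex) n) = 0"
      by (intro poly_eqI) (simp add: coeff_higher_pderiv)
    then show ?thesis
      using True by (simp add: eq F_def fps_X_power_mult_nth)
  next
    case False
    then obtain k where n: "n = k + i"
      using le_Suc_ex[of i n] by (auto simp: add.commute)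
    have p: "(pderiv ^^ i) (monom (1 :: complex) n) = monom (pochhammer (of_nat (Suc k)) i) k"
      by (intro poly_eqI) (simp add: coeff_higher_pderiv n)
    \<comment> \<open>With \<open>n = k + i\<close>, the factor \<open>fact k\<close> cancels the
      denominator of the binomial coefficient and leaves the Pochhammer factor produced by the
      \<open>i\<close>-fold derivative of the monomial.\<close>
    have "fact n = (fact k * pochhammer (of_nat (Suc k)) i :: complex)"
      using pochhammer_product[of k n "1 :: complex"] by (simp add: pochhammer_fact n add.commute)
    moreover have "pochhammer (of_real s) n = pochhammer (complex_of_real s) i * pochhammer (of_real s + of_nat i) k"
      using pochhammer_product[of i n "complex_of_real s"] by (simp add: n)
    moreover have "- c = of_real s + of_nat i"
      by (simp add: c_def)
    then have "c gchoose k = (- 1) ^ k * pochhammer (of_real s + of_nat i) k / fact k"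
      by (simp only: gbinomial_pochhammer)
    then have "fps_nth F n =
        pochhammer (of_real s) i * (u ^ k * pochhammer (of_real s + of_nat i) k / fact k)"
      using False
      using power_mult_distrib[of "- u" "- 1" k]
      by (simp add: F_def fps_X_power_mult_nth fps_compose_linear n)
    ultimately show ?thesis
      by (simp add: eq p poly_monom)
  qed
qed

text \<open>Dividing by the Pochhammer symbols undoes the weights in the Taylor coefficients of the
  kernel, so the kernel with parameter \<open>u\<close> is sent to the value of \<open>p\<close> at
  \<open>u\<close>.\<close>

definition kernel_functional :: "real \<Rightarrow> complex poly \<Rightarrow> (complex \<Rightarrow> complex) \<Rightarrow> complex" where
  "kernel_functional s p h =
     (\<Sum>n\<le>degree p. coeff p n * (deriv ^^ n) h 0 / pochhammer (of_real s) n)"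

lemma kernel_functional_kernel_deriv:
  assumes "0 < s"
  shows "kernel_functional s p (kernel_deriv s i u) = poly ((pderiv ^^ i) p) u"
proof -
  have "pochhammer (complex_of_real s) n \<noteq> 0" for n
    using pochhammer_pos[OF assms, of n] by (simp add: pochhammer_of_real)
  then have "kernel_functional s p (kernel_deriv s i u) =
      (\<Sum>n\<le>degree p. coeff p n * poly ((pderiv ^^ i) (monom 1 n)) u)"
    by (simp add: kernel_functional_def higher_deriv_kernel_deriv)
  also have "\<dots> = (\<Sum>n\<le>degree p. poly ((pderiv ^^ i) (monom (coeff p n) n)) u)"
  proof (rule sum.cong[OF refl])
    fix n
    have "(pderiv ^^ i) (monom (coeff p n) n) = smult (coeff p n) ((pderiv ^^ i) (monom 1 n))"
      unfolding higher_pderiv_smult[symmetric] by (simp add: smult_monom)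
    then show "coeff p n * poly ((pderiv ^^ i) (monom 1 n)) u = poly ((pderiv ^^ i) (monom (coeff p n) n)) u"
      by simp
  qed
  also have "\<dots> = poly ((pderiv ^^ i) (\<Sum>n\<le>degree p. monom (coeff p n) n)) u"
    by (simp add: higher_pderiv_sum poly_sum)
  finally show ?thesis by (simp add: poly_as_sum_of_monoms)
qed

lemma kernel_functional_diff:
  assumes "f holomorphic_on ball 0 1" "g holomorphic_on ball 0 1"
  shows "kernel_functional s p (\<lambda>z. f z - c * g z) =
    kernel_functional s p f - c * kernel_functional s p g"
proof -
  have "(deriv ^^ n) (\<lambda>z. f z - c * g z) 0 = (deriv ^^ n) f 0 - c * (deriv ^^ n) g 0" for n
  proof -
    have "(deriv ^^ n) (\<lambda>z. f z - c * g z) 0 = (deriv ^^ n) f 0 - (deriv ^^ n) (\<lambda>z. c * g z) 0"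
      using assms by (intro higher_deriv_diff[of _ "ball 0 1"]) (auto intro: holomorphic_intros)
    also have "(deriv ^^ n) (\<lambda>z. c * g z) 0 = c * (deriv ^^ n) g 0"
      using assms by (intro higher_deriv_cmult[of _ "ball 0 1"]) auto
    finally show ?thesis .
  qed
  then show ?thesis
    by (simp add: kernel_functional_def sum_distrib_left sum_subtractf[symmetric]
        diff_divide_distrib right_diff_distrib mult_ac)
qed

text \<open>Only the germ at 0 enters. This matters because the generated kernels are identified
  with the explicit ones on the disc only.\<close>

lemma kernel_functional_cong:
  assumes "f holomorphic_on ball 0 1" "\<And>z. z \<in> ball 0 1 \<Longrightarrow> f z = g z"
  shows "kernel_functional s p f = kernel_functional s p g"
proof -
  have "g holomorphic_on ball 0 1"
    using assms by (metis holomorphic_cong)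
  then have "(deriv ^^ n) f 0 = (deriv ^^ n) g 0" for n
    using assms by (intro higher_deriv_transform_within_open[of _ "ball 0 1"]) auto
  then show ?thesis by (simp add: kernel_functional_def)
qed

section \<open>Orders of vanishing and multiplicities in the tuple\<close>

lemma order_higher_pderiv:
  fixes p :: "'a :: field_char_0 poly"
  assumes "p \<noteq> 0" "i \<le> order x p"
  shows "(pderiv ^^ i) p \<noteq> 0 \<and> order x ((pderiv ^^ i) p) = order x p - i"
  using assms(2)
proof (induction i)
  case 0
  then show ?case using assms by simp
next
  case (Suc i)
  define q where "q = (pderiv ^^ i) p"
  have q: "q \<noteq> 0" "order x q = order x p - i"
    using Suc by (auto simp: q_def)
  then have root: "poly q x = 0"
    using Suc.prems order_root[of q x] by simp
  \<comment> \<open>In characteristic zero a vanishing derivative forces a constant, and a nonzero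
    constant has no root.\<close>
  have "pderiv q \<noteq> 0"
  proof
    assume "pderiv q = 0"
    then obtain c where "q = [:c:]"
      unfolding pderiv_eq_0_iff by (rule degree_eq_zeroE)
    then show False using q root by simp
  qed
  then show ?case
    using order_pderiv[OF q(1) root] q Suc.prems by (simp add: q_def)
qed

text \<open>The dichotomy behind linear independence: derivatives below the order vanish (the
  kernels already present), and the one of exactly that order does not (the new kernel).\<close>

lemma poly_higher_pderiv_eq_0_iff:
  fixes p :: "'a :: field_char_0 poly"
  assumes "p \<noteq> 0" "i \<le> order x p"
  shows "poly ((pderiv ^^ i) p) x = 0 \<longleftrightarrow> i < order x p"
  using order_higher_pderiv[OF assms] order_root[of "(pderiv ^^ i) p" x] assms by auto

text \<open>The roots are the conjugate nodes, matching the conjugated parameter of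
  \<open>kernel_deriv\<close>.\<close>

definition node_poly :: "complex list \<Rightarrow> complex poly" where
  "node_poly a = (\<Prod>x\<leftarrow>a. [:- cnj x, 1:])"

lemma node_poly_Cons: "node_poly (x # a) = [:- cnj x, 1:] * node_poly a"
  by (simp add: node_poly_def del: mult_pCons_left)

lemma node_poly_nonzero: "node_poly a \<noteq> 0"
  by (auto simp: node_poly_def prod_list_zero_iff)

lemma order_node_poly: "order (cnj b) (node_poly a) = count_list a b"
proof (induction a)
  case Nil
  then show ?case by (simp add: node_poly_def)
next
  case (Cons x a)
  have "order (cnj b) (node_poly (x # a)) = order (cnj b) [:- cnj x, 1:] + order (cnj b) (node_poly a)"
    using order_mult[of "[:- cnj x, 1:]" "node_poly a"] node_poly_nonzero[of "x # a"]
    unfolding node_poly_Cons by blast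
  moreover have "order (cnj b) [:- cnj x, 1:] = (if x = b then 1 else 0)"
    using order_power_n_n[of "cnj b" 1] by (auto intro!: order_0I)
  ultimately show ?case using Cons by simp
qed

lemma count_list_take_le: "count_list (take n a) x \<le> count_list a x"
  by (metis append_take_drop_id count_list_append le_add1)

lemma multiplicity_at_bounds:
  assumes "j < length a"
  shows "0 < multiplicity_at a j" "multiplicity_at a j \<le> count_list a (a ! j)"
proof -
  show "0 < multiplicity_at a j"
    using assms by (simp add: multiplicity_at_def take_Suc_conv_app_nth)
  show "multiplicity_at a j \<le> count_list a (a ! j)"
    by (simp add: multiplicity_at_def count_list_take_le)
qed

lemma multiplicity_at_append: "j < length a \<Longrightarrow> multiplicity_at (a @ [b]) j = multiplicity_at a j"
  by (simp add: multiplicity_at_def nth_append)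

lemma multiplicity_at_last: "multiplicity_at (a @ [b]) (length a) = Suc (count_list a b)"
  by (simp add: multiplicity_at_def)

text \<open>Successive occurrences of \<open>x\<close> carry the multiplicities 1, 2, and so on.
  Hence every derivative order below the count is represented among the generated kernels.\<close>

lemma exists_multiplicity_at:
  assumes "i < count_list a x"
  shows "\<exists>j<length a. a ! j = x \<and> multiplicity_at a j = Suc i"
  using assms
proof (induction a rule: rev_induct)
  case (snoc y a)
  show ?case
  proof (cases "i < count_list a x")
    case True
    then obtain j where "j < length a" "a ! j = x" "multiplicity_at a j = Suc i"
      using snoc.IH by blast
    then show ?thesis
      by (intro exI[of _ j]) (simp add: nth_append multiplicity_at_append)
  next
    case False
    then have "y = x" "i = count_list a x"
      using snoc.prems by (auto split: if_splits)
    then show ?thesis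
      by (intro exI[of _ "length a"]) (simp add: multiplicity_at_last)
  qed
qed simp

lemma gen_kernel_append: "j < length a \<Longrightarrow> gen_kernel \<alpha> (a @ [b]) j = gen_kernel \<alpha> a j"
  by (rule ext) (simp add: gen_kernel_def multiplicity_at_append nth_append)

text \<open>Multiplicities look only at the prefix of the tuple, so appending \<open>b\<close>
  leaves the earlier kernels and their orthonormalization unchanged.\<close>

lemma gen_kernels_append:
  "gen_kernels \<alpha> (a @ [b]) = gen_kernels \<alpha> a @ [gen_kernel \<alpha> (a @ [b]) (length a)]"
  by (simp add: gen_kernels_def gen_kernel_append)

lemma next_basis_fun_eq:
  "next_basis_fun \<alpha> a b =
     gram_schmidt_step \<alpha> (gram_schmidt \<alpha> (gen_kernels \<alpha> a)) (gen_kernel \<alpha> (a @ [b]) (length a))"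
  by (simp add: next_basis_fun_def gen_kernels_append gram_schmidt_snoc)

lemma gen_kernel_last_eq:
  assumes "set a \<subseteq> ball 0 1" "b \<in> ball 0 1" "z \<in> ball 0 1"
  shows "gen_kernel \<alpha> (a @ [b]) (length a) z = kernel_deriv (2 + \<alpha>) (count_list a b) (cnj b) z"
  using gen_kernel_eq[of "length a" "a @ [b]" z \<alpha>] assms by (simp add: multiplicity_at_last)

text \<open>The subtracted components can be added back one at a time, starting with the
  last.\<close>

lemma mem_if_orth_residual_mem:
  assumes V: "lin_closed V" and Bs: "set Bs \<subseteq> V" and P: "orth_residual \<alpha> Bs v \<in> V"
  shows "v \<in> V"
  using Bs P
proof (induction Bs rule: rev_induct)
  case (snoc e Bs)
  then have "(\<lambda>z. orth_residual \<alpha> (Bs @ [e]) v z - (- bergman_inner \<alpha> v e) * e z) \<in> V"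
    by (intro lin_closedD[OF V]) auto
  then have "orth_residual \<alpha> Bs v \<in> V"
    by (simp add: orth_residual_snoc)
  then show ?case using snoc by simp
qed (simp add: orth_residual_Nil)

subsection \<open>Continuity in the disc\<close>

lemma bergman_L2_cong:
  assumes "\<And>z. z \<in> ball 0 1 \<Longrightarrow> f z = g z"
  shows "f \<in> bergman_L2 \<alpha> \<longleftrightarrow> g \<in> bergman_L2 \<alpha>"
proof -
  have "f \<in> borel_measurable (bergman_measure \<alpha>) \<longleftrightarrow> g \<in> borel_measurable (bergman_measure \<alpha>)"
    using assms by (intro measurable_cong) (simp add: space_bergman_measure)
  moreover have "integrable (bergman_measure \<alpha>) (\<lambda>z. (cmod (f z))\<^sup>2) \<longleftrightarrow>
      integrable (bergman_measure \<alpha>) (\<lambda>z. (cmod (g z))\<^sup>2)"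
    using assms by (intro Bochner_Integration.integrable_cong) (simp_all add: space_bergman_measure)
  ultimately show ?thesis by (simp add: square_integrable_def)
qed

lemma bergman_norm_eq_0I:
  assumes "\<And>z. z \<in> ball 0 1 \<Longrightarrow> h z = 0"
  shows "bergman_norm \<alpha> h = 0"
proof -
  have "(LINT z|bergman_measure \<alpha>. (cmod (h z))\<^sup>2) = (LINT z|bergman_measure \<alpha>. 0)"
    using assms by (intro Bochner_Integration.integral_cong) (simp_all add: space_bergman_measure)
  then show ?thesis by (simp add: bergman_norm_def)
qed

lemma residual_nullI:
  assumes "set Bs \<subseteq> bergman_L2 \<alpha>" "h \<in> bergman_L2 \<alpha>" "bergman_norm \<alpha> h = 0"
  shows "h \<in> residual_null \<alpha> Bs"
  using norm_orth_residual_le[OF assms(1)] bergman_norm_nonneg[of \<alpha> "orth_residual \<alpha> Bs h"] assms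
  by (fastforce simp: residual_null_def intro: antisym)

lemma gen_kernels_L2:
  assumes "-1 < \<alpha>" "set a \<subseteq> ball 0 1"
  shows "set (gen_kernels \<alpha> a) \<subseteq> bergman_L2 \<alpha>"
proof
  fix h assume "h \<in> set (gen_kernels \<alpha> a)"
  then obtain j where j: "j < length a" "h = gen_kernel \<alpha> a j"
    by (auto simp: gen_kernels_def)
  then have "a ! j \<in> ball 0 1"
    using assms(2) nth_mem by blast
  then have "kernel_deriv (2 + \<alpha>) (multiplicity_at a j - 1) (cnj (a ! j)) \<in> bergman_L2 \<alpha>"
    using assms(1) by (intro kernel_deriv_in_L2) auto
  then show "h \<in> bergman_L2 \<alpha>"
    unfolding j(2) by (rule iffD2[OF bergman_L2_cong, rotated]) (rule gen_kernel_eq[OF j(1) assms(2)])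
qed

abbreviation node_basis :: "real \<Rightarrow> complex list \<Rightarrow> (complex \<Rightarrow> complex) list" where
  "node_basis \<alpha> a \<equiv> gram_schmidt \<alpha> (gen_kernels \<alpha> a)"

lemma node_basis_L2:
  assumes "-1 < \<alpha>" "set a \<subseteq> ball 0 1"
  shows "set (node_basis \<alpha> a) \<subseteq> bergman_L2 \<alpha>"
  using gram_schmidt_closed[OF lin_closed_L2 gen_kernels_L2[OF assms]] .

text \<open>The generated kernel is the explicit derivative on the disc, where the measure lives.
  The difference is therefore a null function, and rescaling by the factor 1 applies.\<close>

lemma norm_inner_next_basis_fun:
  assumes \<alpha>: "-1 < \<alpha>" and a: "set a \<subseteq> ball 0 1" and b: "b \<in> ball 0 1" and f: "f \<in> bergman_L2 \<alpha>"
  shows "cmod (bergman_inner \<alpha> f (next_basis_fun \<alpha> a b)) =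
    cmod (bergman_inner \<alpha> f
      (gram_schmidt_step \<alpha> (node_basis \<alpha> a) (kernel_deriv (2 + \<alpha>) (count_list a b) (cnj b))))"
  unfolding next_basis_fun_eq
proof (rule norm_inner_gram_schmidt_step_cong[OF f node_basis_L2[OF \<alpha> a], where c = 1])
  let ?g = "gen_kernel \<alpha> (a @ [b]) (length a)"
  let ?k = "kernel_deriv (2 + \<alpha>) (count_list a b) (cnj b)"
  have eq: "?g z = ?k z" if "z \<in> ball 0 1" for z
    using gen_kernel_last_eq[OF a b that] .
  show k: "?k \<in> bergman_L2 \<alpha>"
    using \<alpha> b by (intro kernel_deriv_in_L2) auto
  then show g: "?g \<in> bergman_L2 \<alpha>"
    by (rule iffD2[OF bergman_L2_cong, rotated]) (rule eq)
  have "(\<lambda>z. ?g z - ?k z) \<in> residual_null \<alpha> (node_basis \<alpha> a)"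
    using k g eq
    by (intro residual_nullI node_basis_L2 \<alpha> a square_integrable_diff bergman_norm_eq_0I) auto
  then show "(\<lambda>z. ?g z - 1 * ?k z) \<in> residual_null \<alpha> (node_basis \<alpha> a)"
    by simp
qed simp

text \<open>The occurrences of \<open>b\<close> in the tuple supply this derivative, up to a null
  function, as an input vector of Gram-Schmidt. These are the Taylor terms that disappear in the
  continuity proof.\<close>

lemma kernel_deriv_residual_null:
  assumes \<alpha>: "-1 < \<alpha>" and a: "set a \<subseteq> ball 0 1" and i: "i < count_list a b"
  shows "kernel_deriv (2 + \<alpha>) i (cnj b) \<in> residual_null \<alpha> (node_basis \<alpha> a)"
proof -
  obtain j where j: "j < length a" "a ! j = b" "multiplicity_at a j = Suc i"
    using exists_multiplicity_at[OF i] by blast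
  let ?g = "gen_kernel \<alpha> a j" and ?k = "kernel_deriv (2 + \<alpha>) i (cnj b)"
  note V = lin_closed_residual_null[OF node_basis_L2[OF \<alpha> a]]
  have b: "b \<in> ball 0 1"
    using a j nth_mem by blast
  have g_in: "?g \<in> set (gen_kernels \<alpha> a)"
    using j by (simp add: gen_kernels_def)
  have g: "?g \<in> residual_null \<alpha> (node_basis \<alpha> a)"
    using gram_schmidt_residual_null[OF gen_kernels_L2[OF \<alpha> a]] g_in by blast
  have k: "?k \<in> bergman_L2 \<alpha>"
    using \<alpha> b by (intro kernel_deriv_in_L2) auto
  have "(\<lambda>z. ?g z - ?k z) \<in> residual_null \<alpha> (node_basis \<alpha> a)"
  proof (intro residual_nullI node_basis_L2 \<alpha> a square_integrable_diff k bergman_norm_eq_0I)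
    show "?g \<in> bergman_L2 \<alpha>"
      using g by (simp add: residual_null_def)
    show "?g z - ?k z = 0" if "z \<in> ball 0 1" for z
      using gen_kernel_eq[OF j(1) a that, of \<alpha>] j by simp
  qed
  from lin_closedD[OF V g this, of 1] show ?thesis by simp
qed

text \<open>If the residual were null, the functional of the node polynomial would kill it along
  with the basis at the nodes, hence also the new kernel. But the new kernel is mapped to a
  derivative of order exactly \<open>order (cnj b) (node_poly a)\<close>, which is nonzero at
  \<open>cnj b\<close>.\<close>

lemma orth_residual_kernel_deriv_nonzero:
  assumes \<alpha>: "-1 < \<alpha>" and a: "set a \<subseteq> ball 0 1" and b: "b \<in> ball 0 1"
  shows "bergman_norm \<alpha> (orth_residual \<alpha> (node_basis \<alpha> a)
    (kernel_deriv (2 + \<alpha>) (count_list a b) (cnj b))) \<noteq> 0"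
proof
  let ?\<Lambda> = "kernel_functional (2 + \<alpha>) (node_poly a)"
  let ?k = "kernel_deriv (2 + \<alpha>) (count_list a b) (cnj b)"
  let ?P = "orth_residual \<alpha> (node_basis \<alpha> a) ?k"
  assume 0: "bergman_norm \<alpha> ?P = 0"
  have s: "0 < 2 + \<alpha>" using \<alpha> by simp
  \<comment> \<open>The functional is linear on holomorphic functions, so its kernel
    \<open>V\<close> is formed inside \<open>H\<close>.\<close>
  define H where "H = {h \<in> bergman_L2 \<alpha>. h holomorphic_on ball 0 1}"
  define V where "V = {h \<in> H. ?\<Lambda> h = 0}"
  have H: "lin_closed H"
    by (auto simp: lin_closed_def H_def intro!: holomorphic_intros
        intro: lin_closedD[OF lin_closed_L2])
  then have V: "lin_closed V"
    by (auto simp: lin_closed_def V_def kernel_functional_diff H_def)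
  have kH: "kernel_deriv (2 + \<alpha>) i (cnj x) \<in> H" if "x \<in> ball 0 1" for i x
    using that \<alpha> unfolding H_def by (auto intro!: kernel_deriv_in_L2 holomorphic_kernel_deriv)
  have "set (gen_kernels \<alpha> a) \<subseteq> V"
  proof
    fix h assume "h \<in> set (gen_kernels \<alpha> a)"
    then obtain j where j: "j < length a" "h = gen_kernel \<alpha> a j"
      by (auto simp: gen_kernels_def)
    let ?g = "kernel_deriv (2 + \<alpha>) (multiplicity_at a j - 1) (cnj (a ! j))"
    have aj: "a ! j \<in> ball 0 1" using a j nth_mem by blast
    have eq: "?g z = h z" if "z \<in> ball 0 1" for z
      using gen_kernel_eq[OF j(1) a that] j(2) by simp
    have "h \<in> bergman_L2 \<alpha>"
      using kH[OF aj] by (intro iffD1[OF bergman_L2_cong, OF eq]) (simp_all add: H_def)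
    moreover have "h holomorphic_on ball 0 1"
      using kH[OF aj] by (intro iffD1[OF holomorphic_cong, OF refl eq]) (simp_all add: H_def)
    ultimately have "h \<in> H" by (simp add: H_def)
    moreover have "?\<Lambda> ?g = ?\<Lambda> h"
      using kH[OF aj] eq by (intro kernel_functional_cong) (auto simp: H_def)
    moreover have "?\<Lambda> ?g = 0"
    proof -
      have "multiplicity_at a j - 1 < order (cnj (a ! j)) (node_poly a)"
        using multiplicity_at_bounds[OF j(1)] by (simp add: order_node_poly)
      then show ?thesis
        by (simp only: kernel_functional_kernel_deriv[OF s] less_imp_le
            poly_higher_pderiv_eq_0_iff[OF node_poly_nonzero])
    qed
    ultimately show "h \<in> V" by (simp add: V_def)
  qed
  then have Bs: "set (node_basis \<alpha> a) \<subseteq> V"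
    by (rule gram_schmidt_closed[OF V])
  then have PH: "?P \<in> H"
    by (intro orth_residual_closed[OF H] kH b) (auto simp: V_def)
  \<comment> \<open>The functional reads derivatives at 0, so vanishing in norm must first become
    pointwise vanishing.\<close>
  have "?P z = 0" if "z \<in> ball 0 1" for z
    using bergman_norm_0_imp_0[OF \<alpha> _ _ 0 that] PH
    by (simp add: H_def holomorphic_on_imp_continuous_on)
  then have "?\<Lambda> ?P = ?\<Lambda> (\<lambda>_. 0)"
    using PH by (intro kernel_functional_cong) (auto simp: H_def)
  then have "?P \<in> V"
    using PH by (simp add: V_def kernel_functional_def)
  then have "?k \<in> V"
    using mem_if_orth_residual_mem[OF V Bs] by blast
  then have "poly ((pderiv ^^ count_list a b) (node_poly a)) (cnj b) = 0"
    by (simp add: V_def kernel_functional_kernel_deriv[OF s])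
  then show False
    by (simp add: poly_higher_pderiv_eq_0_iff[OF node_poly_nonzero] order_node_poly)
qed

text \<open>Taylor expansion in the parameter on the convex disc of radius \<open>r\<close>. The
  remainder bound is uniform in \<open>z\<close>, so it passes to the norm by integration.\<close>

lemma kernel_Taylor:
  assumes s: "0 < s" and r: "r < 1" and u: "cmod u \<le> r" and v: "cmod v \<le> r" and z: "cmod z < 1"
  shows "cmod (kernel_deriv s 0 v z - (\<Sum>i\<le>m. kernel_deriv s i u z * (v - u) ^ i / fact i))
    \<le> (cmod (pochhammer (of_real s) (Suc m)) * (1 - r) powr (- (s + real (Suc m))))
        * cmod (v - u) ^ Suc m / fact m"
proof (rule complex_Taylor[of "cball 0 r" m "\<lambda>i x. kernel_deriv s i x z"])
  fix x assume x: "x \<in> cball (0 :: complex) r"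
  have "cmod (kernel_deriv s (Suc m) x z) \<le>
      cmod (pochhammer (of_real s) (Suc m)) * (1 - cmod x) powr (- (s + real (Suc m)))"
    using s r x z by (intro norm_kernel_deriv_le) auto
  also have "\<dots> \<le> cmod (pochhammer (of_real s) (Suc m)) * (1 - r) powr (- (s + real (Suc m)))"
    using s r x by (intro mult_left_mono powr_mono2') auto
  finally show "cmod (kernel_deriv s (Suc m) x z) \<le>
    cmod (pochhammer (of_real s) (Suc m)) * (1 - r) powr (- (s + real (Suc m)))" .
  show "((\<lambda>x. kernel_deriv s i x z) has_field_derivative kernel_deriv s (Suc i) x z) (at x within cball 0 r)" for i
    using r x z by (intro kernel_deriv_has_field_derivative[THEN has_field_derivative_at_within]) auto
qed (use u v in auto)

lemma tendsto_next_basis_fun: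
  assumes \<alpha>: "-1 < \<alpha>" and a: "set a \<subseteq> ball 0 1" and b: "b \<in> ball 0 1" and f: "f \<in> bergman_L2 \<alpha>"
  shows "((\<lambda>x. cmod (bergman_inner \<alpha> f (next_basis_fun \<alpha> a x))) \<longlongrightarrow>
    cmod (bergman_inner \<alpha> f (next_basis_fun \<alpha> a b))) (at b)"
proof -
  define s where "s = 2 + \<alpha>"
  define m where "m = count_list a b"
  define Bs where "Bs = node_basis \<alpha> a"
  \<comment> \<open>\<open>c x\<close> is the coefficient of the first Taylor term that survives
    \<open>P\<close>, and \<open>T x\<close> removes the terms before it. For \<open>b\<close>
    outside the tuple, \<open>m = 0\<close>, \<open>c x = 1\<close> and
    \<open>T x = 0\<close>.\<close>
  define c where "c x = cnj (x - b) ^ m / fact m" for x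
  define T where "T x z = (\<Sum>i<m. (- (cnj (x - b) ^ i / fact i)) * kernel_deriv s i (cnj b) z)" for x z
  \<comment> \<open>Modulo the span of the kernels at the nodes, \<open>w x\<close> is a nonzero multiple of the kernel at \<open>x\<close>.\<close>
  define w where "w x z = (kernel_deriv s 0 (cnj x) z + T x z) / c x" for x z
  \<comment> \<open>Halfway between \<open>cmod b\<close> and 1, so that one Taylor constant
    \<open>B\<close> serves a whole neighbourhood of \<open>b\<close>.\<close>
  define r where "r = (1 + cmod b) / 2"
  define B where "B = cmod (pochhammer (complex_of_real s) (Suc m)) * (1 - r) powr (- (s + real (Suc m)))"
  have s: "0 < s" using \<alpha> by (simp add: s_def)
  have r: "cmod b < r" "r < 1" using b by (simp_all add: r_def)
  have B: "B \<ge> 0" by (simp add: B_def)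
  note BsL = node_basis_L2[OF \<alpha> a, folded Bs_def]
  have kL: "kernel_deriv s i (cnj x) \<in> bergman_L2 \<alpha>" if "x \<in> ball 0 1" for i x
    using \<alpha> s that by (intro kernel_deriv_in_L2) auto
  have kN: "kernel_deriv s i (cnj b) \<in> residual_null \<alpha> Bs" if "i < m" for i
    using kernel_deriv_residual_null[OF \<alpha> a] that by (simp add: s_def m_def Bs_def)
  have TN: "(\<lambda>z. - T x z) \<in> residual_null \<alpha> Bs" for x
  proof -
    have "(\<lambda>_. 0) \<in> bergman_L2 \<alpha>" by (simp add: square_integrable_def)
    then have "(\<lambda>_. 0) \<in> residual_null \<alpha> Bs"
      by (intro residual_nullI BsL bergman_norm_eq_0I) auto
    from lin_closed_sum[OF lin_closed_residual_null[OF BsL] this, of "{..<m}"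
        "\<lambda>i. kernel_deriv s i (cnj b)" "\<lambda>i. - (cnj (x - b) ^ i / fact i)"] kN
    show ?thesis by (simp add: T_def)
  qed
  have TL: "T x \<in> bergman_L2 \<alpha>" for x
    using square_integrable_cmult[of "\<lambda>z. - T x z" _ "-1"] TN[of x] by (simp add: residual_null_def)
  have wL: "w x \<in> bergman_L2 \<alpha>" if "x \<in> ball 0 1" for x
    unfolding w_def[abs_def] by (intro square_integrable_divide square_integrable_add kL TL that)
  \<comment> \<open>Avoiding the other nodes makes the multiplicity at \<open>x\<close> zero, so the
    kernel itself is used there, whatever the multiplicity at \<open>b\<close>.\<close>
  have ev: "\<forall>\<^sub>F x in at b. x \<noteq> b \<and> cmod x < r \<and> x \<notin> set a - {b}"
  proof -
    have "\<forall>\<^sub>F x in at b. x \<in> ball 0 r - (set a - {b})"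
      using r by (intro eventually_at_in_open') (auto intro!: open_Diff finite_imp_closed)
    then show ?thesis
      using eventually_neq_at_within[of b b UNIV] by eventually_elim auto
  qed
  have lim: "((\<lambda>x. bergman_norm \<alpha> (\<lambda>z. w x z - kernel_deriv s m (cnj b) z)) \<longlongrightarrow> 0) (at b)"
  proof (rule Lim_null_comparison)
    define C where "C = B * sqrt (measure (bergman_measure \<alpha>) (ball 0 1))"
    have "((\<lambda>x. C * cmod (x - b)) \<longlongrightarrow> C * cmod (b - b)) (at b)"
      by (intro tendsto_intros)
    then show "((\<lambda>x. C * cmod (x - b)) \<longlongrightarrow> 0) (at b)" by simp
    show "\<forall>\<^sub>F x in at b. norm (bergman_norm \<alpha> (\<lambda>z. w x z - kernel_deriv s m (cnj b) z)) \<le> C * cmod (x - b)"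
      using ev
    proof eventually_elim
      case (elim x)
      then have x: "x \<in> ball 0 1" "x \<noteq> b" using r by auto
      have cx: "cmod (c x) = cmod (x - b) ^ m / fact m" "c x \<noteq> 0"
        using x unfolding c_def norm_divide norm_power complex_mod_cnj by simp_all
      have bound: "cmod (w x z - kernel_deriv s m (cnj b) z) \<le> B * cmod (x - b)" if z: "z \<in> ball 0 1" for z
      proof -
        \<comment> \<open>The remainder also subtracts the term of order \<open>m\<close>; after
          division by \<open>c x\<close> that term becomes the limit vector, and the remaining error
          is of order \<open>cmod (x - b)\<close>.\<close>
        let ?R = "kernel_deriv s 0 (cnj x) z -
          (\<Sum>i\<le>m. kernel_deriv s i (cnj b) z * (cnj x - cnj b) ^ i / fact i)"
        have "T x z = - (\<Sum>i<m. kernel_deriv s i (cnj b) z * (cnj x - cnj b) ^ i / fact i)"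
          unfolding T_def sum_negf[symmetric] by (intro sum.cong) auto
        then have R: "?R = kernel_deriv s 0 (cnj x) z + T x z - kernel_deriv s m (cnj b) z * c x"
          by (simp add: c_def lessThan_Suc_atMost[symmetric])
        have "w x z - kernel_deriv s m (cnj b) z = ?R / c x"
          unfolding R using cx(2) by (simp add: w_def diff_divide_distrib)
        then have "cmod (w x z - kernel_deriv s m (cnj b) z) = cmod ?R / cmod (c x)"
          by (simp add: norm_divide)
        also have "\<dots> \<le> (B * cmod (cnj x - cnj b) ^ Suc m / fact m) / cmod (c x)"
          unfolding B_def using kernel_Taylor[OF s r(2), of "cnj b" "cnj x" z m] elim r(1) z
          by (intro divide_right_mono) auto
        also have "cmod (cnj x - cnj b) = cmod (x - b)"
          by (metis complex_cnj_diff complex_mod_cnj)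
        also have "(B * cmod (x - b) ^ Suc m / fact m) / cmod (c x) = B * cmod (x - b)"
          using x by (simp add: cx(1))
        finally show ?thesis .
      qed
      have "bergman_norm \<alpha> (\<lambda>z. w x z - kernel_deriv s m (cnj b) z)
          \<le> (B * cmod (x - b)) * sqrt (measure (bergman_measure \<alpha>) (ball 0 1))"
        using B by (intro bergman_norm_le_bound \<alpha> square_integrable_diff wL x kL b bound) auto
      then show ?case by (simp add: C_def bergman_norm_nonneg mult_ac)
    qed
  qed
  have "((\<lambda>x. cmod (bergman_inner \<alpha> f (gram_schmidt_step \<alpha> Bs (w x)))) \<longlongrightarrow>
      cmod (bergman_inner \<alpha> f (gram_schmidt_step \<alpha> Bs (kernel_deriv s m (cnj b))))) (at b)"
  proof (rule tendsto_gram_schmidt_step[OF f BsL kL[OF b] _ _ lim])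
    show "\<forall>\<^sub>F x in at b. w x \<in> bergman_L2 \<alpha>"
      using ev by eventually_elim (use r in \<open>auto intro!: wL\<close>)
    show "bergman_norm \<alpha> (orth_residual \<alpha> Bs (kernel_deriv s m (cnj b))) \<noteq> 0"
      using orth_residual_kernel_deriv_nonzero[OF \<alpha> a b] by (simp add: Bs_def s_def m_def)
  qed
  also have "cmod (bergman_inner \<alpha> f (gram_schmidt_step \<alpha> Bs (kernel_deriv s m (cnj b)))) =
      cmod (bergman_inner \<alpha> f (next_basis_fun \<alpha> a b))"
    using norm_inner_next_basis_fun[OF \<alpha> a b f] by (simp add: Bs_def s_def m_def)
  finally show ?thesis
  proof (rule Lim_transform_eventually)
    show "\<forall>\<^sub>F x in at b. cmod (bergman_inner \<alpha> f (gram_schmidt_step \<alpha> Bs (w x))) =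
        cmod (bergman_inner \<alpha> f (next_basis_fun \<alpha> a x))"
      using ev
    proof eventually_elim
      case (elim x)
      then have x: "x \<in> ball 0 1" "x \<noteq> b" "count_list a x = 0" using r by auto
      have cx: "c x \<noteq> 0" using x by (simp add: c_def)
      \<comment> \<open>The kernel at \<open>x\<close> differs from a nonzero multiple of
        \<open>w x\<close> by a vector annihilated by \<open>P\<close>, so both give the same
        value.\<close>
      have "(\<lambda>z. kernel_deriv s 0 (cnj x) z - c x * w x z) = (\<lambda>z. - T x z)"
        using cx by (simp add: w_def)
      then have "cmod (bergman_inner \<alpha> f (gram_schmidt_step \<alpha> Bs (kernel_deriv s 0 (cnj x)))) =
          cmod (bergman_inner \<alpha> f (gram_schmidt_step \<alpha> Bs (w x)))"
        using TN[of x] by (intro norm_inner_gram_schmidt_step_cong[OF f BsL kL[OF x(1)] wL[OF x(1)] cx]) simp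
      then show ?case
        using norm_inner_next_basis_fun[OF \<alpha> a x(1) f] x(3) by (simp add: Bs_def s_def)
    qed
  qed
qed

subsection \<open>Behaviour at the boundary\<close>

lemma borel_imp_bergman_measurable:
  "f \<in> borel_measurable borel \<Longrightarrow> f \<in> borel_measurable (bergman_measure \<alpha>)"
  unfolding measurable_cong_sets[OF sets_bergman_measure refl] by (rule measurable_restrict_space1)

lemma bergman_L2_indicator:
  fixes f :: "complex \<Rightarrow> complex"
  assumes f: "f \<in> bergman_L2 \<alpha>" and A: "A \<in> sets borel"
  shows "(\<lambda>z. indicator A z * f z) \<in> bergman_L2 \<alpha>"
proof -
  have m: "(\<lambda>z. indicator A z * f z) \<in> borel_measurable (bergman_measure \<alpha>)"
    by (intro borel_measurable_times borel_imp_bergman_measurable[OF borel_measurable_indicator[OF A]]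
        square_integrable_measurable[OF f])
  have "integrable (bergman_measure \<alpha>) (\<lambda>z. (cmod (indicator A z * f z))\<^sup>2)"
  proof (rule Bochner_Integration.integrable_bound)
    show "integrable (bergman_measure \<alpha>) (\<lambda>z. (cmod (f z))\<^sup>2)"
      using f by (simp add: square_integrable_def)
    show "(\<lambda>z. (cmod (indicator A z * f z))\<^sup>2) \<in> borel_measurable (bergman_measure \<alpha>)"
      using m by simp
  qed (auto simp: indicator_def)
  then show ?thesis using m by (simp add: square_integrable_def)
qed

text \<open>Dominated convergence: each point of the disc eventually lies in the growing balls, and
  the square of the modulus of \<open>g\<close> dominates.\<close>

lemma bergman_norm_outside_ball_tendsto_0:
  assumes g: "g \<in> bergman_L2 \<alpha>"
  shows "(\<lambda>n. bergman_norm \<alpha> (\<lambda>z. indicator (- ball 0 (1 - 1 / real (Suc n))) z * g z)) \<longlonglongrightarrow> 0"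
proof -
  let ?A = "\<lambda>n. - ball (0 :: complex) (1 - 1 / real (Suc n))"
  have "(\<lambda>n. LINT z|bergman_measure \<alpha>. (cmod (indicator (?A n) z * g z))\<^sup>2)
      \<longlonglongrightarrow> (LINT z|bergman_measure \<alpha>. 0)"
  proof (rule integral_dominated_convergence[where w = "\<lambda>z. (cmod (g z))\<^sup>2"])
    show "integrable (bergman_measure \<alpha>) (\<lambda>z. (cmod (g z))\<^sup>2)"
      using g by (simp add: square_integrable_def)
    show "(\<lambda>z. (cmod (indicator (?A n) z * g z))\<^sup>2) \<in> borel_measurable (bergman_measure \<alpha>)" for n
      using square_integrable_measurable[OF bergman_L2_indicator[OF g, of "?A n"]]
      by (intro borel_measurable_power borel_measurable_norm) auto
    show "AE z in bergman_measure \<alpha>. norm ((cmod (indicator (?A n) z * g z))\<^sup>2) \<le> (cmod (g z))\<^sup>2" for n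
      by (auto simp: indicator_def)
    show "AE z in bergman_measure \<alpha>. (\<lambda>n. (cmod (indicator (?A n) z * g z))\<^sup>2) \<longlonglongrightarrow> 0"
    proof (rule AE_I2)
      fix z assume "z \<in> space (bergman_measure \<alpha>)"
      then have z: "cmod z < 1" by (simp add: space_bergman_measure)
      have "(\<lambda>n. 1 - 1 / real (Suc n)) \<longlonglongrightarrow> 1 - 0"
        using LIMSEQ_inverse_real_of_nat by (intro tendsto_intros) (simp add: inverse_eq_divide)
      then have "\<forall>\<^sub>F n in sequentially. cmod z < 1 - 1 / real (Suc n)"
        using z by (intro order_tendstoD(1)) auto
      then have "\<forall>\<^sub>F n in sequentially. (cmod (indicator (?A n) z * g z))\<^sup>2 = 0"
        by eventually_elim simp
      then show "(\<lambda>n. (cmod (indicator (?A n) z * g z))\<^sup>2) \<longlonglongrightarrow> 0"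
        by (rule tendsto_eventually)
    qed
  qed simp
  from tendsto_real_sqrt[OF this] show ?thesis
    by (simp add: bergman_norm_def)
qed

text \<open>Put \<open>t = 1 - cmod b\<close>. On the ball of radius \<open>t / 2\<close> about
  \<open>b\<close>, \<open>1 - (cmod z)\<^sup>2\<close> is comparable to \<open>t\<close> within a
  factor 3, so the density is at least a multiple of \<open>t powr \<alpha>\<close>; the area
  contributes the factor \<open>t\<^sup>2\<close>.\<close>

lemma measure_bergman_ball_ge:
  assumes \<alpha>: "-1 < \<alpha>" and b: "b \<in> ball 0 1"
  shows "(1 + \<alpha>) * 3 powr (- \<bar>\<alpha>\<bar>) / 4 * (1 - cmod b) powr (2 + \<alpha>)
    \<le> measure (bergman_measure \<alpha>) (ball b ((1 - cmod b) / 2))"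
proof -
  interpret finite_measure "bergman_measure \<alpha>"
    by (rule finite_measure_bergman_measure) fact
  define t where "t = 1 - cmod b"
  have t: "0 < t" using b by (simp add: t_def)
  define D where "D = (1 + \<alpha>) / pi * (t powr \<alpha> * 3 powr (- \<bar>\<alpha>\<bar>))"
  have D: "D \<ge> 0" using \<alpha> by (simp add: D_def)
  have near: "t / 2 \<le> 1 - cmod z" "1 - cmod z \<le> 3 * t / 2" if "z \<in> ball b (t / 2)" for z
    using that norm_triangle_ineq2[of z b] norm_triangle_ineq2[of b z]
    by (auto simp: t_def dist_norm norm_minus_commute)
  then have sub: "ball b (t / 2) \<subseteq> ball 0 1" using t by force
  have dens: "D \<le> (1 + \<alpha>) * (1 - (cmod z)\<^sup>2) powr \<alpha> / pi" if z: "z \<in> ball b (t / 2)" for z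
  proof -
    define x where "x = 1 - (cmod z)\<^sup>2"
    have x_eq: "x = (1 - cmod z) * (1 + cmod z)" by (simp add: x_def power2_eq_square algebra_simps)
    have "(1 - cmod z) * 1 \<le> x" "x \<le> (1 - cmod z) * 2"
      unfolding x_eq using near[OF z] t by (intro mult_left_mono; simp)+
    then have x: "t / 2 \<le> x" "x \<le> 3 * t" using near[OF z] by simp_all
    then have "3 powr (- \<bar>\<alpha>\<bar>) \<le> (x / t) powr \<alpha>"
      using t by (intro powr_between) (auto simp: field_simps)
    then have "t powr \<alpha> * 3 powr (- \<bar>\<alpha>\<bar>) \<le> t powr \<alpha> * (x / t) powr \<alpha>"
      by (intro mult_left_mono) auto
    also have "\<dots> = x powr \<alpha>"
      using t x by (simp add: powr_mult[symmetric])
    finally have "(1 + \<alpha>) / pi * (t powr \<alpha> * 3 powr (- \<bar>\<alpha>\<bar>)) \<le> (1 + \<alpha>) / pi * x powr \<alpha>"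
      using \<alpha> by (intro mult_left_mono) auto
    then show ?thesis by (simp add: D_def x_def)
  qed
  have "ennreal (D * (pi * (t / 2)\<^sup>2)) = ennreal D * emeasure lborel (ball b (t / 2))"
    using t D by (simp add: emeasure_lborel_complex_ball ennreal_mult)
  also have "\<dots> = (\<integral>\<^sup>+ z. ennreal D * indicator (ball b (t / 2)) z \<partial>lborel)"
    by (simp add: nn_integral_cmult_indicator)
  also have "\<dots> \<le> (\<integral>\<^sup>+ z. ennreal ((1 + \<alpha>) * (1 - (cmod z)\<^sup>2) powr \<alpha> / pi) * indicator (ball b (t / 2)) z \<partial>lborel)"
  proof (rule nn_integral_mono)
    show "ennreal D * indicator (ball b (t / 2)) z \<le>
        ennreal ((1 + \<alpha>) * (1 - (cmod z)\<^sup>2) powr \<alpha> / pi) * indicator (ball b (t / 2)) z" for z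
      by (cases "z \<in> ball b (t / 2)") (use dens[of z] in \<open>auto intro: ennreal_leI\<close>)
  qed
  also have "\<dots> = ennreal (measure (bergman_measure \<alpha>) (ball b (t / 2)))"
    using sub by (simp add: emeasure_bergman_measure[symmetric] emeasure_eq_measure)
  finally have "D * (pi * (t / 2)\<^sup>2) \<le> measure (bergman_measure \<alpha>) (ball b (t / 2))"
    by (simp add: measure_nonneg)
  moreover have "t powr (2 + \<alpha>) = t\<^sup>2 * t powr \<alpha>"
    using t by (simp add: powr_add)
  ultimately show ?thesis
    by (simp add: D_def t_def power_divide mult_ac)
qed

lemma norm_kernel_deriv_0:
  "cmod (kernel_deriv s 0 u z) = cmod (1 - u * z) powr (- s)"
proof -
  have "cmod ((1 - u * z) powr (- of_real s)) = cmod (1 - u * z) powr (- s)"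
    by (subst norm_powr_real_powr') auto
  then show ?thesis by (simp add: kernel_deriv_def)
qed

text \<open>Restrict the integral to the ball of the previous estimate. There the squared kernel is
  at least of size \<open>t powr (- 2 * s)\<close>, and the measure is at least of size
  \<open>t powr s\<close>.\<close>

lemma kernel_norm_lower_bound:
  assumes \<alpha>: "-1 < \<alpha>"
  shows "\<exists>c>0. \<forall>b\<in>ball 0 1.
    c * (1 - cmod b) powr (- (2 + \<alpha>)) \<le> (bergman_norm \<alpha> (kernel_deriv (2 + \<alpha>) 0 (cnj b)))\<^sup>2"
proof -
  interpret finite_measure "bergman_measure \<alpha>"
    by (rule finite_measure_bergman_measure) fact
  define s where "s = 2 + \<alpha>"
  have s: "0 < s" using \<alpha> by (simp add: s_def)
  define c where "c = (5 / 2) powr (- 2 * s) * ((1 + \<alpha>) * 3 powr (- \<bar>\<alpha>\<bar>) / 4)"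
  have "c > 0" using \<alpha> by (simp add: c_def)
  moreover have "c * (1 - cmod b) powr (- s) \<le> (bergman_norm \<alpha> (kernel_deriv s 0 (cnj b)))\<^sup>2"
    if b: "b \<in> ball 0 1" for b
  proof -
    define t where "t = 1 - cmod b"
    have t: "0 < t" "t \<le> 1" using b by (simp_all add: t_def)
    define A where "A = ball b (t / 2)"
    have kL: "kernel_deriv s 0 (cnj b) \<in> bergman_L2 \<alpha>"
      using b \<alpha> s by (intro kernel_deriv_in_L2) auto
    have Asub: "A \<subseteq> ball 0 1"
    proof
      fix z assume "z \<in> A"
      then show "z \<in> ball 0 1"
        using norm_triangle_ineq2[of z b] t by (auto simp: A_def t_def dist_norm norm_minus_commute)
    qed
    then have A: "A \<in> sets (bergman_measure \<alpha>)"
      unfolding sets_bergman_measure by (subst sets_restrict_space_iff) (auto simp: A_def)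
    have low: "(5 * t / 2) powr (- 2 * s) \<le> (cmod (kernel_deriv s 0 (cnj b) z))\<^sup>2" if z: "z \<in> A" for z
    proof -
      have z1: "cmod z < 1" using z Asub by auto
      \<comment> \<open>This splitting bounds the modulus by \<open>2 * t + t / 2\<close>, the
        source of the constant \<open>5 / 2\<close>.\<close>
      have "1 - cnj b * z = of_real (1 - (cmod b)\<^sup>2) + cnj b * (b - z)"
        using complex_norm_square[of b] by (simp add: algebra_simps)
      then have "cmod (1 - cnj b * z) \<le> \<bar>1 - (cmod b)\<^sup>2\<bar> + cmod b * cmod (b - z)"
        by (metis complex_mod_cnj norm_mult norm_of_real norm_triangle_ineq)
      also have "\<bar>1 - (cmod b)\<^sup>2\<bar> = t * (1 + cmod b)"
        using b abs_square_less_1[of "cmod b"] by (simp add: t_def power2_eq_square algebra_simps)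
      also have "t * (1 + cmod b) + cmod b * cmod (b - z) \<le> t * 2 + 1 * (t / 2)"
        using b t z by (intro add_mono mult_mono) (auto simp: A_def dist_norm)
      finally have "cmod (1 - cnj b * z) \<le> 5 * t / 2" by simp
      moreover have "0 < Re (1 - cnj b * z)"
        using b z1 by (intro Re_one_minus_pos) auto
      then have "0 < cmod (1 - cnj b * z)"
        using complex_Re_le_cmod less_le_trans by blast
      ultimately have "(5 * t / 2) powr (- 2 * s) \<le> cmod (1 - cnj b * z) powr (- 2 * s)"
        using s by (intro powr_mono2') auto
      also have "\<dots> = (cmod (kernel_deriv s 0 (cnj b) z))\<^sup>2"
        by (simp add: norm_kernel_deriv_0 power2_eq_square powr_add[symmetric])
      finally show ?thesis .
    qed
    have "(5 / 2 * t) powr (- 2 * s) * t powr s = (5 / 2) powr (- 2 * s) * t powr (- s)"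
      using t by (subst powr_mult) (auto simp: powr_add[symmetric])
    then have "c * t powr (- s) = (5 * t / 2) powr (- 2 * s) * ((1 + \<alpha>) * 3 powr (- \<bar>\<alpha>\<bar>) / 4 * t powr s)"
      by (simp add: c_def mult_ac)
    also have "\<dots> \<le> (5 * t / 2) powr (- 2 * s) * measure (bergman_measure \<alpha>) A"
      using measure_bergman_ball_ge[OF \<alpha> b] by (intro mult_left_mono) (auto simp: A_def t_def s_def)
    also have "\<dots> = (LINT z|bergman_measure \<alpha>. (5 * t / 2) powr (- 2 * s) * indicator A z)"
      using A by simp
    also have "\<dots> \<le> (bergman_norm \<alpha> (kernel_deriv s 0 (cnj b)))\<^sup>2"
      unfolding bergman_norm_power2
    proof (rule integral_mono)
      show "integrable (bergman_measure \<alpha>) (\<lambda>z. (5 * t / 2) powr (- 2 * s) * indicator A z)"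
        using A by (intro integrable_mult_right) (simp add: emeasure_eq_measure)
      show "integrable (bergman_measure \<alpha>) (\<lambda>z. (cmod (kernel_deriv s 0 (cnj b) z))\<^sup>2)"
        using kL by (simp add: square_integrable_def)
    qed (use low in \<open>auto simp: indicator_def\<close>)
    finally show ?thesis by (simp add: t_def)
  qed
  ultimately show ?thesis unfolding s_def by blast
qed

text \<open>Approach to the whole unit circle from inside, without choosing a boundary
  point.\<close>

abbreviation at_boundary :: "complex filter" where
  "at_boundary \<equiv> filtercomap cmod (at_left 1)"

lemma eventually_at_boundary:
  "eventually P at_boundary \<longleftrightarrow> (\<exists>r<1. \<forall>b. r < cmod b \<and> cmod b < 1 \<longrightarrow> P b)"
proof
  assume "eventually P at_boundary"
  then obtain Q where Q: "eventually Q (at_left (1 :: real))" "\<forall>b. Q (cmod b) \<longrightarrow> P b"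
    by (auto simp: eventually_filtercomap)
  then obtain r where "r < 1" "\<forall>y>r. y < 1 \<longrightarrow> Q y"
    by (auto simp: eventually_at_left_field)
  then show "\<exists>r<1. \<forall>b. r < cmod b \<and> cmod b < 1 \<longrightarrow> P b"
    using Q(2) by (intro exI[of _ r]) simp
next
  assume "\<exists>r<1. \<forall>b. r < cmod b \<and> cmod b < 1 \<longrightarrow> P b"
  then obtain r where r: "r < 1" "\<forall>b. r < cmod b \<and> cmod b < 1 \<longrightarrow> P b"
    by blast
  then have "eventually (\<lambda>y. r < y \<and> y < 1) (at_left (1 :: real))"
    by (auto simp: eventually_at_left_field)
  then show "eventually P at_boundary"
    unfolding eventually_filtercomap using r(2) by (intro exI[of _ "\<lambda>y. r < y \<and> y < 1"]) simp
qed

lemma kernel_norm_tendsto_infinity: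
  assumes \<alpha>: "-1 < \<alpha>"
  shows "filterlim (\<lambda>b. bergman_norm \<alpha> (kernel_deriv (2 + \<alpha>) 0 (cnj b))) at_top at_boundary"
proof -
  obtain c where c: "c > 0" "\<And>b. b \<in> ball 0 1 \<Longrightarrow>
      c * (1 - cmod b) powr (- (2 + \<alpha>)) \<le> (bergman_norm \<alpha> (kernel_deriv (2 + \<alpha>) 0 (cnj b)))\<^sup>2"
    using kernel_norm_lower_bound[OF \<alpha>] by blast
  have "filterlim (\<lambda>x. c * (1 - x) powr (- (2 + \<alpha>))) at_top (at_left 1)"
  proof -
    have "((\<lambda>x. 1 - x) \<longlongrightarrow> 1 - 1) (at_left (1 :: real))"
      by (intro tendsto_intros)
    then have "filterlim (\<lambda>x. 1 - x) (at_right 0) (at_left (1 :: real))"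
      by (auto simp: filterlim_at eventually_at_left_field intro: exI[of _ 0])
    then have "filterlim (\<lambda>x. inverse (1 - x)) at_top (at_left (1 :: real))"
      by (rule filterlim_compose[OF filterlim_inverse_at_top_right])
    then have "filterlim (\<lambda>x. ln (inverse (1 - x))) at_top (at_left (1 :: real))"
      by (rule filterlim_compose[OF ln_at_top])
    then have "filterlim (\<lambda>x. (2 + \<alpha>) * ln (inverse (1 - x))) at_top (at_left (1 :: real))"
      using \<alpha> by (intro filterlim_tendsto_pos_mult_at_top[OF tendsto_const]) auto
    then have "filterlim (\<lambda>x. exp ((2 + \<alpha>) * ln (inverse (1 - x)))) at_top (at_left (1 :: real))"
      by (rule filterlim_compose[OF exp_at_top])
    then have "filterlim (\<lambda>x. c * exp ((2 + \<alpha>) * ln (inverse (1 - x)))) at_top (at_left (1 :: real))"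
      using c(1) by (intro filterlim_tendsto_pos_mult_at_top[OF tendsto_const]) auto
    moreover have "\<forall>\<^sub>F x in at_left (1 :: real).
        c * exp ((2 + \<alpha>) * ln (inverse (1 - x))) = c * (1 - x) powr (- (2 + \<alpha>))"
      unfolding eventually_at_left_field
      by (intro exI[of _ 0]) (auto simp: powr_def ln_inverse algebra_simps)
    ultimately show ?thesis
      by (simp only: filterlim_cong[OF refl refl])
  qed
  then have "filterlim (\<lambda>b. c * (1 - cmod b) powr (- (2 + \<alpha>))) at_top at_boundary"
    by (rule filterlim_compose[OF _ filterlim_filtercomap])
  then have "filterlim (\<lambda>b. (bergman_norm \<alpha> (kernel_deriv (2 + \<alpha>) 0 (cnj b)))\<^sup>2) at_top at_boundary"
    by (rule filterlim_at_top_mono) (use c(2) in \<open>auto simp: eventually_at_boundary intro: exI[of _ 0]\<close>)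
  from filterlim_compose[OF sqrt_at_top this] show ?thesis
    by (simp add: bergman_norm_nonneg)
qed

text \<open>Split \<open>g\<close> into a part \<open>g1\<close> on a smaller ball and a part
  \<open>g2\<close> of small norm. The kernels are bounded on that ball uniformly in
  \<open>b\<close>, so their growing norms suppress the contribution of \<open>g1\<close>;
  Cauchy-Schwarz controls that of \<open>g2\<close>.\<close>

lemma normalized_kernel_weak_limit:
  assumes \<alpha>: "-1 < \<alpha>" and g: "g \<in> bergman_L2 \<alpha>"
  shows "((\<lambda>b. bergman_inner \<alpha> (\<lambda>z. kernel_deriv (2 + \<alpha>) 0 (cnj b) z /
    of_real (bergman_norm \<alpha> (kernel_deriv (2 + \<alpha>) 0 (cnj b)))) g) \<longlongrightarrow> 0) at_boundary"
proof (rule tendstoI)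
  fix e :: real assume e: "e > 0"
  define k where "k b = kernel_deriv (2 + \<alpha>) 0 (cnj b)" for b
  define N where "N b = bergman_norm \<alpha> (k b)" for b
  have kL: "k b \<in> bergman_L2 \<alpha>" if "b \<in> ball 0 1" for b
    using \<alpha> that unfolding k_def by (intro kernel_deriv_in_L2) auto
  have "\<forall>\<^sub>F n in sequentially. bergman_norm \<alpha> (\<lambda>z. indicator (- ball 0 (1 - 1 / real (Suc n))) z * g z) < e / 2"
    using e by (intro order_tendstoD(2)[OF bergman_norm_outside_ball_tendsto_0[OF g]]) simp
  then obtain n where n: "bergman_norm \<alpha> (\<lambda>z. indicator (- ball 0 (1 - 1 / real (Suc n))) z * g z) < e / 2"
    by (auto simp: eventually_sequentially)
  define r where "r = 1 - 1 / real (Suc n)"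
  have r: "0 \<le> r" "r < 1" by (simp_all add: r_def divide_simps)
  define g2 where "g2 z = indicator (- ball 0 r) z * g z" for z
  define g1 where "g1 z = indicator (ball 0 r) z * g z" for z
  have g1: "g1 \<in> bergman_L2 \<alpha>" and g2: "g2 \<in> bergman_L2 \<alpha>"
    unfolding g1_def[abs_def] g2_def[abs_def] using g by (auto intro!: bergman_L2_indicator)
  have n2: "bergman_norm \<alpha> g2 < e / 2"
    using n unfolding g2_def[abs_def] r_def .
  \<comment> \<open>Since the measure is finite, constants are square integrable; multiplying by 1
    makes \<open>g1\<close> integrable.\<close>
  have one: "(\<lambda>_. 1) \<in> bergman_L2 \<alpha>"
    by (rule bounded_continuous_in_L2[OF \<alpha>, of _ 1]) auto
  have g1_int: "integrable (bergman_measure \<alpha>) (\<lambda>z. cmod (g1 z))"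
    using square_integrable_norm_mult[OF g1 one] by simp
  define C where "C = (1 - r) powr (- (2 + \<alpha>)) * (LINT z|bergman_measure \<alpha>. cmod (g1 z))"
  have inner1: "cmod (bergman_inner \<alpha> (k b) g1) \<le> C" if b: "b \<in> ball 0 1" for b
  proof -
    have "cmod (bergman_inner \<alpha> (k b) g1) \<le> (LINT z|bergman_measure \<alpha>. cmod (k b z * cnj (g1 z)))"
      unfolding bergman_inner_def by (rule integral_norm_bound)
    also have "\<dots> \<le> (LINT z|bergman_measure \<alpha>. (1 - r) powr (- (2 + \<alpha>)) * cmod (g1 z))"
    proof (rule integral_mono)
      show "integrable (bergman_measure \<alpha>) (\<lambda>z. cmod (k b z * cnj (g1 z)))"
        using square_integrable_norm_mult[OF kL[OF b] g1] by (simp add: norm_mult)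
      show "integrable (bergman_measure \<alpha>) (\<lambda>z. (1 - r) powr (- (2 + \<alpha>)) * cmod (g1 z))"
        using g1_int by simp
      fix z
      show "cmod (k b z * cnj (g1 z)) \<le> (1 - r) powr (- (2 + \<alpha>)) * cmod (g1 z)"
      proof (cases "z \<in> ball 0 r")
        case True
        have "cmod (cnj b * z) \<le> 1 * r"
          unfolding norm_mult using b True by (intro mult_mono) auto
        then have "1 - r \<le> cmod (1 - cnj b * z)"
          using norm_triangle_ineq2[of 1 "cnj b * z"] by simp
        then have "cmod (1 - cnj b * z) powr (- (2 + \<alpha>)) \<le> (1 - r) powr (- (2 + \<alpha>))"
          using r \<alpha> by (intro powr_mono2') auto
        then have "cmod (k b z) \<le> (1 - r) powr (- (2 + \<alpha>))"
          unfolding k_def norm_kernel_deriv_0 .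
        then show ?thesis by (simp add: norm_mult mult_right_mono)
      qed (simp add: g1_def)
    qed
    finally show ?thesis by (simp add: C_def)
  qed
  have top: "filterlim N at_top at_boundary"
    unfolding N_def[abs_def] k_def by (rule kernel_norm_tendsto_infinity[OF \<alpha>])
  have "((\<lambda>b. C / N b) \<longlongrightarrow> 0) at_boundary"
    by (rule real_tendsto_divide_at_top[OF tendsto_const top])
  then have "\<forall>\<^sub>F b in at_boundary. C / N b < e / 2"
    using e by (intro order_tendstoD(2)) auto
  moreover have "\<forall>\<^sub>F b in at_boundary. 0 < N b"
    using top by (simp add: filterlim_at_top_dense)
  moreover have "\<forall>\<^sub>F b in at_boundary. b \<in> ball 0 1"
    by (auto simp: eventually_at_boundary intro: exI[of _ 0])
  ultimately have "\<forall>\<^sub>F b in at_boundary. cmod (bergman_inner \<alpha> (\<lambda>z. k b z / of_real (N b)) g) < e"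
  proof eventually_elim
    case (elim b)
    have eq: "g = (\<lambda>z. g1 z + g2 z)"
      by (auto simp: g1_def g2_def indicator_def)
    have "cmod (bergman_inner \<alpha> g (k b)) = cmod (bergman_inner \<alpha> g1 (k b) + bergman_inner \<alpha> g2 (k b))"
      using g1 g2 kL[OF elim(3)] by (subst eq) (simp add: bergman_inner_add)
    also have "\<dots> \<le> cmod (bergman_inner \<alpha> g1 (k b)) + cmod (bergman_inner \<alpha> g2 (k b))"
      by (rule norm_triangle_ineq)
    also have "\<dots> \<le> C + bergman_norm \<alpha> g2 * N b"
      using inner1[OF elim(3)] bergman_Cauchy_Schwarz[OF g2 kL[OF elim(3)]]
        norm_bergman_inner_commute[of \<alpha> g1 "k b"] by (simp add: N_def)
    also have "\<dots> < e / 2 * N b + e / 2 * N b"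
      using elim n2 by (intro add_strict_mono mult_strict_right_mono) (auto simp: field_simps)
    finally have "cmod (bergman_inner \<alpha> (k b) g) < e * N b"
      unfolding norm_bergman_inner_commute[of \<alpha> g] by simp
    then show ?case
      using elim by (simp add: bergman_inner_divide norm_divide field_simps)
  qed
  then show "\<forall>\<^sub>F b in at_boundary. dist (bergman_inner \<alpha> (\<lambda>z. kernel_deriv (2 + \<alpha>) 0 (cnj b) z /
      of_real (bergman_norm \<alpha> (kernel_deriv (2 + \<alpha>) 0 (cnj b)))) g) 0 < e"
    by (simp add: k_def N_def)
qed

text \<open>The finitely many nodes stay away from the circle, so near it the new vector comes from
  the kernel itself. Rescaling that kernel to norm one preserves the value, and the weak limit
  applies.\<close>

lemma next_basis_fun_tendsto_0:
  assumes \<alpha>: "-1 < \<alpha>" and a: "set a \<subseteq> ball 0 1" and f: "f \<in> bergman_L2 \<alpha>"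
  shows "((\<lambda>b. cmod (bergman_inner \<alpha> f (next_basis_fun \<alpha> a b))) \<longlongrightarrow> 0) at_boundary"
proof -
  define k where "k b = kernel_deriv (2 + \<alpha>) 0 (cnj b)" for b
  define N where "N b = bergman_norm \<alpha> (k b)" for b
  define w where "w b z = k b z / of_real (N b)" for b z
  have kL: "k b \<in> bergman_L2 \<alpha>" if "b \<in> ball 0 1" for b
    using \<alpha> that unfolding k_def by (intro kernel_deriv_in_L2) auto
  have N: "\<forall>\<^sub>F b in at_boundary. 0 < N b"
    using kernel_norm_tendsto_infinity[OF \<alpha>] by (simp add: N_def k_def filterlim_at_top_dense)
  have disc: "\<forall>\<^sub>F b in at_boundary. b \<in> ball 0 1"
    by (auto simp: eventually_at_boundary intro: exI[of _ 0])
  have ev: "\<forall>\<^sub>F b in at_boundary. b \<notin> set a"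
  proof -
    have "\<forall>\<^sub>F b in at_boundary. b \<noteq> x" if "x \<in> set a" for x
      unfolding eventually_at_boundary using that a by (intro exI[of _ "cmod x"]) auto
    then have "\<forall>\<^sub>F b in at_boundary. \<forall>x\<in>set a. b \<noteq> x"
      by (intro eventually_ball_finite) auto
    then show ?thesis by eventually_elim auto
  qed
  have "((\<lambda>b. cmod (bergman_inner \<alpha> f (gram_schmidt_step \<alpha> (node_basis \<alpha> a) (w b)))) \<longlongrightarrow> 0) at_boundary"
  proof (rule tendsto_gram_schmidt_step_weak[OF node_basis_L2[OF \<alpha> a] f])
    show "\<forall>\<^sub>F b in at_boundary. w b \<in> bergman_L2 \<alpha> \<and> bergman_norm \<alpha> (w b) = 1"
      using N disc
      by eventually_elim
        (auto simp: w_def[abs_def] bergman_norm_divide N_def[symmetric] intro!: square_integrable_divide kL)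
    show "((\<lambda>b. bergman_inner \<alpha> (w b) g) \<longlongrightarrow> 0) at_boundary" if "g \<in> bergman_L2 \<alpha>" for g
      using normalized_kernel_weak_limit[OF \<alpha> that] by (simp add: w_def[abs_def] k_def N_def)
  qed
  then show ?thesis
  proof (rule Lim_transform_eventually)
    show "\<forall>\<^sub>F b in at_boundary. cmod (bergman_inner \<alpha> f (gram_schmidt_step \<alpha> (node_basis \<alpha> a) (w b))) =
        cmod (bergman_inner \<alpha> f (next_basis_fun \<alpha> a b))"
      using N disc ev
    proof eventually_elim
      case (elim b)
      have "(\<lambda>z. k b z - of_real (N b) * w b z) = (\<lambda>_. 0)"
        using elim by (simp add: w_def)
      moreover have "(\<lambda>_. 0) \<in> residual_null \<alpha> (node_basis \<alpha> a)"
        by (intro residual_nullI node_basis_L2 \<alpha> a bergman_norm_eq_0I) (simp_all add: square_integrable_def)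
      moreover have "w b \<in> bergman_L2 \<alpha>"
        using kL[OF elim(2)] by (simp add: w_def[abs_def] square_integrable_divide)
      ultimately have "cmod (bergman_inner \<alpha> f (gram_schmidt_step \<alpha> (node_basis \<alpha> a) (k b))) =
          cmod (bergman_inner \<alpha> f (gram_schmidt_step \<alpha> (node_basis \<alpha> a) (w b)))"
        using elim kL[OF elim(2)]
        by (intro norm_inner_gram_schmidt_step_cong[OF f node_basis_L2[OF \<alpha> a], where c = "of_real (N b)"]) auto
      then show ?case
        using norm_inner_next_basis_fun[OF \<alpha> a elim(2) f] elim(3)
        by (simp add: k_def count_list_0_iff)
    qed
  qed
qed

section \<open>Attainment of the supremum\<close>

theorem theorem8p1:
  fixes \<alpha> :: real and f :: "complex \<Rightarrow> complex" and k :: nat and a :: "complex list"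
  assumes "-1 < \<alpha>"
    and "f \<in> bergman_space \<alpha>"
    and "k \<ge> 1"
    and "length a = k - 1"
    and "set a \<subseteq> ball 0 1"
  shows "\<exists>a\<^sub>k\<in>ball 0 1.
    ereal ((cmod (bergman_inner \<alpha> f (next_basis_fun \<alpha> a a\<^sub>k)))\<^sup>2) =
    (SUP b\<in>ball 0 1. ereal ((cmod (bergman_inner \<alpha> f (next_basis_fun \<alpha> a b)))\<^sup>2))"
proof -
  define F where "F b = cmod (bergman_inner \<alpha> f (next_basis_fun \<alpha> a b))" for b
  have f: "f \<in> bergman_L2 \<alpha>"
    using assms(2) bergman_space_subset_L2 by blast
  have cont: "continuous_on (ball 0 1) F"
    unfolding continuous_on_def F_def
    using tendsto_within_subset[OF tendsto_next_basis_fun[OF assms(1,5) _ f] subset_UNIV] by blast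
  have "\<exists>c\<in>ball 0 1. \<forall>b\<in>ball 0 1. F b \<le> F c"
  proof (cases "\<exists>b\<in>ball 0 1. F b > 0")
    case True
    then obtain b0 where b0: "b0 \<in> ball 0 1" "F b0 > 0" by blast
    have "\<forall>\<^sub>F b in at_boundary. F b < F b0"
      using order_tendstoD(2)[OF next_basis_fun_tendsto_0[OF assms(1,5) f]] b0 by (simp add: F_def)
    then obtain r where r: "r < 1" "\<And>b. r < cmod b \<Longrightarrow> cmod b < 1 \<Longrightarrow> F b < F b0"
      unfolding eventually_at_boundary by blast
    \<comment> \<open>Beyond radius \<open>R\<close> the values stay below \<open>F b0\<close>,
      while \<open>b0\<close> lies in the compact disc of radius \<open>R\<close>. A maximum over
      that disc is therefore a maximum over the whole open disc.\<close>
    define R where "R = max r (cmod b0)"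
    have R: "R < 1" "cmod b0 \<le> R" using r b0 by (auto simp: R_def)
    then have "continuous_on (cball 0 R) F"
      by (intro continuous_on_subset[OF cont]) auto
    moreover have "b0 \<in> cball 0 R"
      using R by simp
    ultimately obtain c where c: "c \<in> cball 0 R" "\<And>b. b \<in> cball 0 R \<Longrightarrow> F b \<le> F c"
      using continuous_attains_sup[of "cball 0 R" F] compact_cball[of 0 R] by blast
    have "F b \<le> F c" if "b \<in> ball 0 1" for b
    proof (cases "cmod b \<le> R")
      case False
      then have "F b < F b0" using r(2)[of b] that by (simp add: R_def)
      then show ?thesis using c(2)[of b0] R by simp
    qed (use c in simp)
    then show ?thesis using c R by (intro bexI[of _ c]) auto
  next
    case False
    \<comment> \<open>Here \<open>F\<close> vanishes identically because it is nonnegative, so any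
      point attains the supremum.\<close>
    then have "F b \<le> F 0" if "b \<in> ball 0 1" for b
      using that order_trans[of "F b" 0 "F 0"] by (auto simp: F_def not_less)
    then show ?thesis by (intro bexI[of _ 0]) auto
  qed
  then obtain c where c: "c \<in> ball 0 1" "\<And>b. b \<in> ball 0 1 \<Longrightarrow> F b \<le> F c" by blast
  have "(SUP b\<in>ball 0 1. ereal ((F b)\<^sup>2)) = ereal ((F c)\<^sup>2)"
  proof (rule antisym)
    show "(SUP b\<in>ball 0 1. ereal ((F b)\<^sup>2)) \<le> ereal ((F c)\<^sup>2)"
      using c by (intro SUP_least) (simp add: power_mono F_def)
    show "ereal ((F c)\<^sup>2) \<le> (SUP b\<in>ball 0 1. ereal ((F b)\<^sup>2))"
      using c by (intro SUP_upper)
  qed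
  then show ?thesis using c(1) by (auto simp: F_def)
qed

end
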